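(* Let $0<\lambda_1<1$, $0<\lambda_2\le1$, and let $\mu$ be a finite positive Borel measure on $[0,1)$. Let $X,Y$ be Banach spaces of analytic functions on $\mathbb{D}$, continuously embedded in $H(\mathbb{D})$, with $L^{2,\lambda_1}\subseteq X\subseteq\mathcal{B}^{\frac{3-\lambda_1}{2}}$ and $L^{2,\lambda_2}\subseteq Y\subseteq\mathcal{B}^{\frac{3-\lambda_2}{2}}$. Then $\mathcal{C}_\mu$ is bounded from $X$ into $Y$ if and only if $\mu$ is a $\left(1+\frac{\lambda_2-\lambda_1}{2}\right)$-Carleson measure.
   Context: $\mathbb{D}$ is the open unit disc, $H(\mathbb{D})$ the analytic functions on it. For a finite positive Borel measure $\mu$ on $[0,1)$, $\mu_n=\int_{[0,1)}t^n\,d\mu(t)$ and $\mathcal{C}_\mu(f)(z)=\sum_{n\ge0}\big(\mu_n\sum_{k=0}^n a_k\big)z^n=\int_{[0,1)}\frac{f(tz)}{1-tz}\,d\mu(t)$ for $f=\sum a_nz^n$. For $s>0$, $\mu$ is an $s$-Carleson measure if $\mu([t,1))\le C(1-t)^s$ for all $t\in[0,1)$. $\mathcal{B}^\alpha=\{f\in H(\mathbb{D}):|f(0)|+\sup_{z}(1-|z|^2)^\alpha|f'(z)|<\infty\}$. For $0<\lambda\le1$, the Morrey space $L^{2,\lambda}$ is the set of $f\in H^2$ with $|f(0)|+\sup_{I\subset\partial\mathbb{D}}\big(|I|^{-\lambda}\int_I|f(e^{i\theta})-f_I|^2d\theta\big)^{1/2}<\infty$ ($I$ arcs of length $|I|$,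 $f_I$ the mean of the boundary function over $I$). *)

theory Defs
  imports "HOL-Analysis.Analysis"
begin

text \<open>Unit disc is \<open>ball 0 1\<close>. Functions are \<open>complex \<Rightarrow> complex\<close>; only
their values on the disc matter.\<close>

definition taylor_coeff :: "(complex \<Rightarrow> complex) \<Rightarrow> nat \<Rightarrow> complex" where
  "taylor_coeff f k = (deriv ^^ k) f 0 / of_nat (fact k)"

definition moment :: "real measure \<Rightarrow> nat \<Rightarrow> real" where
  "moment mu n = integral\<^sup>L mu (\<lambda>t. t ^ n)"

definition cesaro_op :: "real measure \<Rightarrow> (complex \<Rightarrow> complex) \<Rightarrow> complex \<Rightarrow> complex" where
  "cesaro_op mu f z =
     (\<Sum>n. complex_of_real (moment mu n) * (\<Sum>k\<le>n. taylor_coeff f k) * z ^ n)"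

definition carleson :: "real measure \<Rightarrow> real \<Rightarrow> bool" where
  "carleson mu s \<longleftrightarrow> (\<exists>C. \<forall>t. 0 \<le> t \<and> t < 1 \<longrightarrow> measure mu {t..<1} \<le> C * (1 - t) powr s)"

definition bloch_type :: "real \<Rightarrow> (complex \<Rightarrow> complex) set" where
  "bloch_type \<alpha> = {f. f holomorphic_on ball 0 1 \<and>
     (\<exists>M. \<forall>z\<in>ball 0 1. (1 - (cmod z)\<^sup>2) powr \<alpha> * cmod (deriv f z) \<le> M)}"

definition hardy2 :: "(complex \<Rightarrow> complex) set" where
  "hardy2 = {f. f holomorphic_on ball 0 1 \<and>
     (\<exists>M. \<forall>r. 0 \<le> r \<and> r < 1 \<longrightarrow>
        (LBINT \<theta>=0..2*pi. (cmod (f (complex_of_real r * cis \<theta>)))\<^sup>2) \<le> M)}"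

definition boundary_fun :: "(complex \<Rightarrow> complex) \<Rightarrow> real \<Rightarrow> complex" where
  "boundary_fun f \<theta> = Lim (at_left 1) (\<lambda>r::real. f (complex_of_real r * cis \<theta>))"

definition arc_mean :: "(complex \<Rightarrow> complex) \<Rightarrow> real \<Rightarrow> real \<Rightarrow> complex" where
  "arc_mean f a l = (CLBINT \<theta>=a..a+l. boundary_fun f \<theta>) / complex_of_real l"

definition morrey :: "real \<Rightarrow> (complex \<Rightarrow> complex) set" where
  "morrey lam = {f. f \<in> hardy2 \<and>
     (\<exists>M. \<forall>a l. 0 < l \<and> l \<le> 2 * pi \<longrightarrow>
        sqrt ((1 / l powr lam) *
          (LBINT \<theta>=a..a+l. (cmod (boundary_fun f \<theta> - arc_mean f a l))\<^sup>2)) \<le> M)}"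

definition subspace_on_disc :: "(complex \<Rightarrow> complex) set \<Rightarrow> (complex \<Rightarrow> complex) set \<Rightarrow> bool" where
  "subspace_on_disc A B \<longleftrightarrow> (\<forall>f\<in>A. \<exists>g\<in>B. \<forall>z\<in>ball 0 1. g z = f z)"

text \<open>\<open>(X, N)\<close> is a Banach space of analytic functions on the disc, continuously
embedded in \<open>H(\<mathbb>D)\<close> (topology of uniform convergence on compact subsets).\<close>
definition banach_analytic :: "(complex \<Rightarrow> complex) set \<Rightarrow> ((complex \<Rightarrow> complex) \<Rightarrow> real) \<Rightarrow> bool" where
  "banach_analytic X N \<longleftrightarrow>
     (\<forall>f\<in>X. f holomorphic_on ball 0 1) \<and>
     (\<lambda>z. 0) \<in> X \<and>
     (\<forall>f\<in>X. \<forall>g\<in>X. (\<lambda>z. f z + g z) \<in> X) \<and>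
     (\<forall>f\<in>X. \<forall>c. (\<lambda>z. c * f z) \<in> X) \<and>
     (\<forall>f\<in>X. 0 \<le> N f) \<and>
     (\<forall>f\<in>X. N f = 0 \<longleftrightarrow> (\<forall>z\<in>ball 0 1. f z = 0)) \<and>
     (\<forall>f\<in>X. \<forall>g\<in>X. N (\<lambda>z. f z + g z) \<le> N f + N g) \<and>
     (\<forall>f\<in>X. \<forall>c. N (\<lambda>z. c * f z) = cmod c * N f) \<and>
     (\<forall>u::nat \<Rightarrow> complex \<Rightarrow> complex. (\<forall>n. u n \<in> X) \<and>
        (\<forall>e>0. \<exists>K. \<forall>m\<ge>K. \<forall>n\<ge>K. N (\<lambda>z. u m z - u n z) < e) \<longrightarrow>
        (\<exists>f\<in>X. (\<lambda>n. N (\<lambda>z. u n z - f z)) \<longlonglongrightarrow> 0)) \<and>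
     (\<forall>K. compact K \<and> K \<subseteq> ball 0 1 \<longrightarrow>
        (\<exists>C. \<forall>f\<in>X. \<forall>z\<in>K. cmod (f z) \<le> C * N f))"

definition bounded_op_on ::
  "((complex \<Rightarrow> complex) \<Rightarrow> complex \<Rightarrow> complex) \<Rightarrow>
   (complex \<Rightarrow> complex) set \<Rightarrow> ((complex \<Rightarrow> complex) \<Rightarrow> real) \<Rightarrow>
   (complex \<Rightarrow> complex) set \<Rightarrow> ((complex \<Rightarrow> complex) \<Rightarrow> real) \<Rightarrow> bool" where
  "bounded_op_on T X NX Y NY \<longleftrightarrow>
     (\<forall>f\<in>X. \<exists>g\<in>Y. \<forall>z\<in>ball 0 1. g z = T f z) \<and>
     (\<exists>C. \<forall>f\<in>X. \<forall>g\<in>Y. (\<forall>z\<in>ball 0 1. g z = T f z) \<longrightarrow> NY g \<le> C * NX f)"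

end

theory Submission
  imports Defs "HOL-Complex_Analysis.Complex_Analysis"
begin

text \<open>
  On the disc, \<open>C\<^sub>\<mu> f(z)\<close> is the integral of \<open>f(tz)/(1 - tz)\<close> against \<open>\<mu>\<close>. Write
  \<open>b = (1 - \<lambda>\<^sub>1)/2\<close> and \<open>s = 1 + (\<lambda>\<^sub>2 - \<lambda>\<^sub>1)/2\<close>.

  Necessity: \<open>F(z) = (1 - z) powr -b\<close> lies in \<open>L\<^bsup>2,\<lambda>\<^sub>1\<^esup>\<close> because its boundary function is small enough
  on every arc. On the radius \<open>C\<^sub>\<mu> F(r)\<close> is the integral of the increasing function
  \<open>(1 - tr) powr -(b + 1)\<close>, so the increment of \<open>C\<^sub>\<mu> F\<close> between \<open>1 - 4\<delta>\<close> and \<open>1 - \<delta>\<close> is at least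
  a constant times \<open>\<delta> powr -(b + 1)\<close> times \<open>\<mu>[1 - \<delta>, 1)\<close>; the Bloch bound controls it from above.

  Sufficiency: a Bloch function satisfies \<open>|f(z)| \<le> M (1 - |z|) powr -b\<close>, so \<open>C\<^sub>\<mu> f\<close> has
  boundary values by dominated convergence. On an arc of length \<open>l\<close> starting at angle \<open>a\<close>, compare them with
  the constant obtained by integrating over \<open>1 - t > l\<close> only, at angle \<open>a\<close>: the part \<open>1 - t > l\<close> is
  controlled by the derivative of \<open>f(w)/(1 - w)\<close>, the part \<open>1 - t \<le> l\<close> by its size,
  where \<open>1/|1 - tz| \<le> (1 - t) powr (\<gamma> - 1) (|1 - cis \<theta>|/2) powr -\<gamma>\<close> with
  \<open>(1 - \<lambda>\<^sub>2)/2 < \<gamma> < 1/2\<close>. Hence \<open>C\<^sub>\<mu>\<close> maps \<open>X\<close> into \<open>Y\<close>, and boundedness is the closed graph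
  theorem.
\<close>

section \<open>Closed graph theorem\<close>

lemma banach_analyticD:
  assumes "banach_analytic X N"
  shows banach_analytic_holomorphic: "f \<in> X \<Longrightarrow> f holomorphic_on ball 0 1"
    and banach_analytic_zero: "(\<lambda>z. 0) \<in> X"
    and banach_analytic_add: "f \<in> X \<Longrightarrow> g \<in> X \<Longrightarrow> (\<lambda>z. f z + g z) \<in> X"
    and banach_analytic_scale: "f \<in> X \<Longrightarrow> (\<lambda>z. c * f z) \<in> X"
    and banach_analytic_norm_nonneg: "f \<in> X \<Longrightarrow> 0 \<le> N f"
    and banach_analytic_norm_eq_0: "f \<in> X \<Longrightarrow> N f = 0 \<longleftrightarrow> (\<forall>z\<in>ball 0 1. f z = 0)"
    and banach_analytic_norm_add: "f \<in> X \<Longrightarrow> g \<in> X \<Longrightarrow> N (\<lambda>z. f z + g z) \<le> N f + N g"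
    and banach_analytic_norm_scale: "f \<in> X \<Longrightarrow> N (\<lambda>z. c * f z) = cmod c * N f"
    and banach_analytic_complete:
      "(\<And>n. u n \<in> X) \<Longrightarrow> (\<And>e. e > 0 \<Longrightarrow> \<exists>K. \<forall>m\<ge>K. \<forall>n\<ge>K. N (\<lambda>z. u m z - u n z) < e) \<Longrightarrow>
       \<exists>f\<in>X. (\<lambda>n. N (\<lambda>z. u n z - f z)) \<longlonglongrightarrow> 0"
    and banach_analytic_eval:
      "compact K \<Longrightarrow> K \<subseteq> ball 0 1 \<Longrightarrow> \<exists>C. \<forall>f\<in>X. \<forall>z\<in>K. cmod (f z) \<le> C * N f"
proof -
  note ax = assms[unfolded banach_analytic_def]
  show "f \<in> X \<Longrightarrow> f holomorphic_on ball 0 1" using ax by simp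
  show "(\<lambda>z. 0) \<in> X" using ax by simp
  show "f \<in> X \<Longrightarrow> g \<in> X \<Longrightarrow> (\<lambda>z. f z + g z) \<in> X" using ax by simp
  show "f \<in> X \<Longrightarrow> (\<lambda>z. c * f z) \<in> X" using ax by simp
  show "f \<in> X \<Longrightarrow> 0 \<le> N f" using ax by simp
  show "f \<in> X \<Longrightarrow> N f = 0 \<longleftrightarrow> (\<forall>z\<in>ball 0 1. f z = 0)" using ax by simp
  show "f \<in> X \<Longrightarrow> g \<in> X \<Longrightarrow> N (\<lambda>z. f z + g z) \<le> N f + N g" using ax by simp
  show "f \<in> X \<Longrightarrow> N (\<lambda>z. c * f z) = cmod c * N f" using ax by simp
  show "(\<And>n. u n \<in> X) \<Longrightarrow> (\<And>e. e > 0 \<Longrightarrow> \<exists>K. \<forall>m\<ge>K. \<forall>n\<ge>K. N (\<lambda>z. u m z - u n z) < e) \<Longrightarrow>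
       \<exists>f\<in>X. (\<lambda>n. N (\<lambda>z. u n z - f z)) \<longlonglongrightarrow> 0" using ax by presburger
  show "compact K \<Longrightarrow> K \<subseteq> ball 0 1 \<Longrightarrow> \<exists>C. \<forall>f\<in>X. \<forall>z\<in>K. cmod (f z) \<le> C * N f" using ax by presburger
qed

section \<open>Norm inequalities for differences\<close>

lemma banach_analytic_diff:
  assumes "banach_analytic X N" "f \<in> X" "g \<in> X"
  shows "(\<lambda>z. f z - g z) \<in> X"
  using banach_analytic_add[OF assms(1,2) banach_analytic_scale[OF assms(1,3), of "-1"]]
  by simp

lemma banach_analytic_norm_minus_commute:
  assumes "banach_analytic X N" "f \<in> X" "g \<in> X"
  shows "N (\<lambda>z. f z - g z) = N (\<lambda>z. g z - f z)"
  using banach_analytic_norm_scale[OF assms(1) banach_analytic_diff[OF assms(1,3,2)], of "-1"]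
  by simp

lemma banach_analytic_norm_triangle:
  assumes "banach_analytic X N" "f \<in> X" "g \<in> X" "h \<in> X"
  shows "N (\<lambda>z. f z - h z) \<le> N (\<lambda>z. f z - g z) + N (\<lambda>z. g z - h z)"
  using banach_analytic_norm_add[OF assms(1) banach_analytic_diff[OF assms(1,2,3)]
      banach_analytic_diff[OF assms(1,3,4)]] by simp

lemma banach_analytic_norm_diff:
  assumes "banach_analytic X N" "f \<in> X" "g \<in> X"
  shows "N (\<lambda>z. f z - g z) \<le> N f + N g"
  using banach_analytic_norm_triangle[OF assms(1,2) banach_analytic_zero[OF assms(1)] assms(3)]
    banach_analytic_norm_minus_commute[OF assms(1) banach_analytic_zero[OF assms(1)] assms(3)]
  by simp

lemma banach_analytic_norm_le_diff:
  assumes "banach_analytic X N" "f \<in> X" "g \<in> X"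
  shows "N f \<le> N (\<lambda>z. f z - g z) + N g"
  using banach_analytic_norm_add[OF assms(1) banach_analytic_diff[OF assms(1,2,3)] assms(3)] by simp

text \<open>Members of \<open>X\<close> are functions on the whole plane, so two of them can agree
  on the disc and still be different objects. Their difference has norm 0, and the triangle
  inequality forces equal norms.\<close>

lemma banach_analytic_norm_cong:
  assumes "banach_analytic X N" "f \<in> X" "g \<in> X" "\<And>z. z \<in> ball 0 1 \<Longrightarrow> f z = g z"
  shows "N f = N g"
proof -
  have le: "N f \<le> N g" if "f \<in> X" "g \<in> X" "\<And>z. z \<in> ball 0 1 \<Longrightarrow> f z = g z" for f g
  proof -
    have "N (\<lambda>z. f z - g z) = 0"
      using banach_analytic_norm_eq_0[OF assms(1) banach_analytic_diff[OF assms(1) that(1,2)]] that(3)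
      by simp
    then show ?thesis using banach_analytic_norm_le_diff[OF assms(1) that(1,2)] by simp
  qed
  show ?thesis using le[of f g] le[of g f] assms by force
qed

text \<open>Increments whose bounds halve at each step leave a tail of at most
  \<open>2 * c / 2 ^ n\<close>. Both the nested balls below and the iteration in the closed graph
  theorem rely on this rate.\<close>

lemma banach_analytic_geometric_limit:
  assumes X: "banach_analytic X N" and u: "\<And>n. u n \<in> X" and "0 \<le> c"
    and step: "\<And>n. N (\<lambda>z. u (Suc n) z - u n z) \<le> c / 2 ^ n"
  obtains f where "f \<in> X" "(\<lambda>n. N (\<lambda>z. u n z - f z)) \<longlonglongrightarrow> 0"
    "\<And>n. N (\<lambda>z. f z - u n z) \<le> 2 * c / 2 ^ n"
proof -
  \<comment> \<open>Keeping the subtracted term \<open>2 * c / 2 ^ (n + k)\<close> makes the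
    induction on \<open>k\<close> close exactly.\<close>
  have tail: "N (\<lambda>z. u (n + k) z - u n z) \<le> 2 * c / 2 ^ n - 2 * c / 2 ^ (n + k)" for n k
  proof (induction k)
    case 0
    show ?case using banach_analytic_norm_eq_0[OF X banach_analytic_zero[OF X]] by simp
  next
    case (Suc k)
    have "N (\<lambda>z. u (n + Suc k) z - u n z) \<le> c / 2 ^ (n + k) + (2 * c / 2 ^ n - 2 * c / 2 ^ (n + k))"
      using banach_analytic_norm_triangle[OF X u[of "Suc (n + k)"] u[of "n + k"] u[of n]] step[of "n + k"] Suc
      by simp
    also have "\<dots> = 2 * c / 2 ^ n - 2 * c / 2 ^ (n + Suc k)"
      by (simp add: field_simps)
    finally show ?case .
  qed
  have tail': "N (\<lambda>z. u m z - u n z) \<le> 2 * c / 2 ^ n" if "n \<le> m" for m n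
  proof -
    have "0 \<le> 2 * c / 2 ^ m" using \<open>0 \<le> c\<close> by simp
    with tail[of n "m - n"] that show ?thesis by simp
  qed
  have lim0: "(\<lambda>n. 2 * c / 2 ^ n) \<longlonglongrightarrow> 0"
    by real_asymp
  have "\<exists>K. \<forall>m\<ge>K. \<forall>n\<ge>K. N (\<lambda>z. u m z - u n z) < e" if e: "e > 0" for e
  proof -
    obtain K where K: "\<And>n. n \<ge> K \<Longrightarrow> 2 * c / 2 ^ n < e"
      using order_tendstoD(2)[OF lim0 e] by (auto simp: eventually_sequentially)
    have "N (\<lambda>z. u m z - u n z) < e" if "m \<ge> K" "n \<ge> K" for m n
      using tail'[of m n] tail'[of n m] K[OF that(1)] K[OF that(2)]
        banach_analytic_norm_minus_commute[OF X u u, of m n] by (cases "m \<le> n") auto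
    then show ?thesis by blast
  qed
  from banach_analytic_complete[OF X, of u, OF u this]
  obtain f where f: "f \<in> X" "(\<lambda>n. N (\<lambda>z. u n z - f z)) \<longlonglongrightarrow> 0"
    by blast
  have "N (\<lambda>z. f z - u n z) \<le> 2 * c / 2 ^ n" for n
  proof (rule tendsto_lowerbound)
    show "(\<lambda>m. N (\<lambda>z. u m z - f z) + 2 * c / 2 ^ n) \<longlonglongrightarrow> 2 * c / 2 ^ n"
      using tendsto_add[OF f(2) tendsto_const[of "2 * c / 2 ^ n"]] by simp
    show "\<forall>\<^sub>F m in sequentially. N (\<lambda>z. f z - u n z) \<le> N (\<lambda>z. u m z - f z) + 2 * c / 2 ^ n"
      using eventually_ge_at_top[of n]
    proof eventually_elim
      case (elim m)
      then show ?case
        using banach_analytic_norm_triangle[OF X f(1) u[of m] u[of n]] tail'[of n m]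
          banach_analytic_norm_minus_commute[OF X f(1) u, of m] by simp
    qed
  qed simp
  with f show ?thesis using that by blast
qed

text \<open>Baire category by nested balls, for a space given as a set with a norm. If no
  \<open>A n\<close> were dense in any ball, balls could be chosen one after another, ball number
  \<open>n + 1\<close> missing \<open>A n\<close>, and the limit of their centres would lie in no
  \<open>A n\<close>.\<close>

lemma banach_analytic_Baire:
  assumes X: "banach_analytic X N" and cover: "X \<subseteq> (\<Union>n::nat. A n)"
  obtains n f r where "f \<in> X" "r > 0"
    "\<And>g e. g \<in> X \<Longrightarrow> N (\<lambda>z. g z - f z) < r \<Longrightarrow> e > 0 \<Longrightarrow> \<exists>h\<in>A n. N (\<lambda>z. g z - h z) < e"
proof (rule ccontr)
  note wit = that
  assume "\<not> thesis"
  then have neg: "\<exists>g e. g \<in> X \<and> N (\<lambda>z. g z - f z) < r \<and> e > 0 \<and> (\<forall>h\<in>A n. \<not> N (\<lambda>z. g z - h z) < e)"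
    if "f \<in> X" "r > 0" for n f r
    using wit that by blast
  \<comment> \<open>A pair is a ball, given by centre and radius. The quarter radius in
    \<open>Q\<close> keeps the limit within half of each radius, so strictly inside every
    ball.\<close>
  define P where "P = (\<lambda>k (p :: (complex \<Rightarrow> complex) \<times> real). fst p \<in> X \<and> 0 < snd p \<and> snd p \<le> 1 / 2 ^ k)"
  define Q where "Q = (\<lambda>k (p :: (complex \<Rightarrow> complex) \<times> real) q.
      N (\<lambda>z. fst q z - fst p z) < snd p / 4 \<and> snd q \<le> snd p / 2 \<and>
      (\<forall>h\<in>A k. snd q \<le> N (\<lambda>z. fst q z - h z)))"
  have "\<exists>p. \<forall>n. P n (p n) \<and> Q n (p n) (p (Suc n))"
  proof (rule dependent_nat_choice)
    show "\<exists>p. P 0 p"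
      unfolding P_def using banach_analytic_zero[OF X] by (intro exI[of _ "(\<lambda>z. 0, 1)"]) simp
  next
    fix p k assume p: "P k p"
    obtain g e where g: "g \<in> X" "N (\<lambda>z. g z - fst p z) < snd p / 4" "e > 0"
      "\<forall>h\<in>A k. \<not> N (\<lambda>z. g z - h z) < e"
      using neg[of "fst p" "snd p / 4" k] p unfolding P_def by auto
    show "\<exists>q. P (Suc k) q \<and> Q k p q"
      unfolding P_def Q_def using g p
      by (intro exI[of _ "(g, min e (snd p / 2))"]) (force simp: P_def min_def not_less)
  qed
  then obtain p where p: "\<And>n. P n (p n)" "\<And>n. Q n (p n) (p (Suc n))" by blast
  define u r where "u = (\<lambda>n. fst (p n))" and "r = (\<lambda>n. snd (p n))"
  have u: "u n \<in> X" "0 < r n" "r n \<le> 1 / 2 ^ n" "N (\<lambda>z. u (Suc n) z - u n z) < r n / 4"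
    "r (Suc n) \<le> r n / 2" for n
    using p[of n] by (auto simp: P_def Q_def u_def r_def)
  have away: "r (Suc n) \<le> N (\<lambda>z. u (Suc n) z - h z)" if "h \<in> A n" for n h
    using p(2)[of n] that by (auto simp: P_def Q_def u_def r_def)
  have shift: "r (n + k) \<le> r n / 2 ^ k" for n k
  proof (induction k)
    case (Suc k)
    have "r (n + Suc k) \<le> r (n + k) / 2" using u(5)[of "n + k"] by simp
    also have "\<dots> \<le> r n / 2 ^ k / 2" using Suc by (intro divide_right_mono) auto
    finally show ?case by simp
  qed simp
  \<comment> \<open>Restarted at \<open>n\<close>, the sequence moves by at most
    \<open>r n / 4 / 2 ^ k\<close>, so its limit is within \<open>r n / 2\<close>. That limit
    \<open>f'\<close> comes from a second use of completeness and is identified with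
    \<open>f\<close> only through the vanishing norm of the difference.\<close>
  have close: "N (\<lambda>z. f z - u n z) \<le> r n / 2"
    if "f \<in> X" "(\<lambda>n. N (\<lambda>z. u n z - f z)) \<longlonglongrightarrow> 0" for f n
  proof -
    have st: "N (\<lambda>z. u (n + Suc k) z - u (n + k) z) \<le> (r n / 4) / 2 ^ k" for k
      using u(4)[of "n + k"] shift[of n k] by simp
    have "0 \<le> r n / 4" using u(2)[of n] by simp
    from banach_analytic_geometric_limit[OF X, of "\<lambda>k. u (n + k)", OF u(1) this st]
    obtain f' where f': "f' \<in> X" "(\<lambda>k. N (\<lambda>z. u (n + k) z - f' z)) \<longlonglongrightarrow> 0"
        "\<And>k. N (\<lambda>z. f' z - u (n + k) z) \<le> 2 * (r n / 4) / 2 ^ k" by blast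
    have "(\<lambda>k. N (\<lambda>z. u (n + k) z - f z)) \<longlonglongrightarrow> 0"
      using LIMSEQ_ignore_initial_segment[OF that(2), of n] by (simp add: add.commute)
    then have "(\<lambda>k. N (\<lambda>z. u (n + k) z - f z) + N (\<lambda>z. u (n + k) z - f' z)) \<longlonglongrightarrow> 0"
      using tendsto_add[OF _ f'(2)] by fastforce
    then have "N (\<lambda>z. f z - f' z) \<le> 0"
    proof (rule tendsto_lowerbound)
      show "\<forall>\<^sub>F k in sequentially. N (\<lambda>z. f z - f' z) \<le> N (\<lambda>z. u (n + k) z - f z) + N (\<lambda>z. u (n + k) z - f' z)"
        using banach_analytic_norm_triangle[OF X that(1) u(1) f'(1)]
          banach_analytic_norm_minus_commute[OF X that(1) u(1)] by (auto intro!: always_eventually)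
    qed simp
    then show ?thesis
      using f'(3)[of 0] banach_analytic_norm_triangle[OF X that(1) f'(1) u(1), of n] by simp
  qed
  have "N (\<lambda>z. u (Suc n) z - u n z) \<le> 1 / 2 ^ n" for n
    using u(2,3,4)[of n] by linarith
  from banach_analytic_geometric_limit[OF X, of u 1, OF u(1) _ this]
  obtain f where f: "f \<in> X" "(\<lambda>n. N (\<lambda>z. u n z - f z)) \<longlonglongrightarrow> 0"
    by auto
  obtain n where "f \<in> A n" using cover f(1) by blast
  \<comment> \<open>The distance from \<open>u (Suc n)\<close> to \<open>f \<in> A n\<close> is at
    least \<open>r (Suc n)\<close> by \<open>away\<close> and at most half of it by
    \<open>close\<close>.\<close>
  then show False
    using away[of f n] close[OF f, of "Suc n"] u(2)[of "Suc n"]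
      banach_analytic_norm_minus_commute[OF X f(1) u(1), of "Suc n"] by simp
qed

text \<open>\<open>eval\<close> takes the place of a closed graph: it makes \<open>T f z\<close>
  continuous in \<open>f\<close>, while convergence in \<open>Y\<close> implies pointwise
  convergence. The sets of \<open>f\<close> with an image of norm at most \<open>n\<close> cover
  \<open>X\<close>; the one that is dense in a ball yields approximations to any \<open>f\<close>
  with controlled images, and iterating on the remainders sums them to \<open>f\<close>.\<close>

theorem banach_analytic_closed_graph:
  assumes X: "banach_analytic X NX" and Y: "banach_analytic Y NY"
    and into: "\<And>f. f \<in> X \<Longrightarrow> \<exists>g\<in>Y. \<forall>z\<in>ball 0 1. g z = T f z"
    and diff: "\<And>f g z. f \<in> X \<Longrightarrow> g \<in> X \<Longrightarrow> z \<in> ball 0 1 \<Longrightarrow> T (\<lambda>w. f w - g w) z = T f z - T g z"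
    and scale: "\<And>f c z. f \<in> X \<Longrightarrow> z \<in> ball 0 1 \<Longrightarrow> T (\<lambda>w. c * f w) z = c * T f z"
    and eval: "\<And>z. z \<in> ball 0 1 \<Longrightarrow> \<exists>C. \<forall>f\<in>X. cmod (T f z) \<le> C * NX f"
  shows "bounded_op_on T X NX Y NY"
proof -
  \<comment> \<open>The graph of \<open>T\<close>, with images taken up to their values off the
    disc.\<close>
  define R where "R = (\<lambda>f g. f \<in> X \<and> g \<in> Y \<and> (\<forall>z\<in>ball 0 1. g z = T f z))"
  have R_diff: "R (\<lambda>z. f z - f' z) (\<lambda>z. g z - g' z)" if "R f g" "R f' g'" for f g f' g'
    using that diff banach_analytic_diff[OF X] banach_analytic_diff[OF Y] by (auto simp: R_def)
  have R_scale: "R (\<lambda>z. c * f z) (\<lambda>z. c * g z)" if "R f g" for f g c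
    using that scale banach_analytic_scale[OF X] banach_analytic_scale[OF Y] by (auto simp: R_def)
  have T0: "T f z = 0" if "f \<in> X" "NX f = 0" "z \<in> ball 0 1" for f z
    using eval[OF that(3)] that by fastforce
  define A where "A = (\<lambda>n::nat. {f. \<exists>g. R f g \<and> NY g \<le> real n})"
  have "X \<subseteq> (\<Union>n. A n)"
  proof
    fix f assume "f \<in> X"
    then obtain g where "R f g" using into unfolding R_def by blast
    moreover obtain n where "NY g \<le> real n" using real_arch_simple by blast
    ultimately show "f \<in> (\<Union>n. A n)" unfolding A_def by blast
  qed
  from banach_analytic_Baire[OF X this] obtain n f0 r where f0: "f0 \<in> X" "r > 0"
    and dense: "\<And>g e. g \<in> X \<Longrightarrow> NX (\<lambda>z. g z - f0 z) < r \<Longrightarrow> e > 0 \<Longrightarrow> \<exists>h\<in>A n. NX (\<lambda>z. g z - h z) < e"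
    by metis
  \<comment> \<open>Multiplying by \<open>c = r / (2 * NX f)\<close> scales \<open>f\<close> to norm
    \<open>r / 2\<close>. A difference of two members of \<open>A n\<close> has an image of norm at
    most \<open>2 * n\<close>, and dividing by \<open>c\<close> gives \<open>4 * n / r\<close> times
    \<open>NX f\<close>.\<close>
  define K where "K = 4 * real n / r"
  have K: "K \<ge> 0" using f0 by (simp add: K_def)
  have approx: "\<exists>h g. R h g \<and> NX (\<lambda>z. f z - h z) \<le> e \<and> NY g \<le> K * NX f" if f: "f \<in> X" and "e > 0" for f e
  proof (cases "NX f = 0")
    case True
    then show ?thesis
      using f T0[OF f True] banach_analytic_zero[OF Y] banach_analytic_norm_eq_0[OF Y banach_analytic_zero[OF Y]]
        banach_analytic_norm_eq_0[OF X banach_analytic_zero[OF X]] \<open>e > 0\<close>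
      by (intro exI[of _ f] exI[of _ "\<lambda>z. 0"]) (auto simp: R_def)
  next
    case False
    then have pos: "NX f > 0" using banach_analytic_norm_nonneg[OF X f] by simp
    define c where "c = r / (2 * NX f)"
    have c: "c > 0" using pos f0 by (simp add: c_def)
    have cX: "(\<lambda>z. complex_of_real c * f z) \<in> X" using banach_analytic_scale[OF X f] .
    \<comment> \<open>The point \<open>c * f + f0\<close> of the ball is approximated by
      \<open>h1\<close> and its centre by \<open>h2\<close>, each up to \<open>e * c / 2\<close>, so
      \<open>(h1 - h2) / c\<close> approximates \<open>f\<close> up to \<open>e\<close>.\<close>
    have "NX (\<lambda>z. (complex_of_real c * f z + f0 z) - f0 z) = c * NX f"
      using banach_analytic_norm_scale[OF X f] c by simp
    also have "\<dots> < r" using pos f0 by (simp add: c_def)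
    finally obtain h1 where h1: "h1 \<in> A n" "NX (\<lambda>z. (complex_of_real c * f z + f0 z) - h1 z) < e * c / 2"
      using dense[OF banach_analytic_add[OF X cX f0(1)], of "e * c / 2"] c \<open>e > 0\<close> by auto
    have "NX (\<lambda>z. f0 z - f0 z) = 0" using banach_analytic_norm_eq_0[OF X banach_analytic_zero[OF X]] by simp
    then obtain h2 where h2: "h2 \<in> A n" "NX (\<lambda>z. f0 z - h2 z) < e * c / 2"
      using dense[OF f0(1), of "e * c / 2"] c \<open>e > 0\<close> f0(2) by auto
    obtain g1 g2 where g: "R h1 g1" "NY g1 \<le> n" "R h2 g2" "NY g2 \<le> n"
      using h1 h2 by (auto simp: A_def)
    have hX: "h1 \<in> X" "h2 \<in> X" and gY: "g1 \<in> Y" "g2 \<in> Y" using g by (auto simp: R_def)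
    let ?c = "complex_of_real (1 / c)"
    let ?h = "\<lambda>z. ?c * (h1 z - h2 z)" and ?g = "\<lambda>z. ?c * (g1 z - g2 z)"
    have D1: "(\<lambda>z. (complex_of_real c * f z + f0 z) - h1 z) \<in> X"
      by (intro banach_analytic_diff[OF X] banach_analytic_add[OF X] cX f0 hX)
    have D2: "(\<lambda>z. f0 z - h2 z) \<in> X" by (intro banach_analytic_diff[OF X] f0 hX)
    have "(\<lambda>z. f z - ?h z) =
        (\<lambda>z. ?c * (((complex_of_real c * f z + f0 z) - h1 z) - (f0 z - h2 z)))"
      using c by (auto simp: field_simps)
    then have "NX (\<lambda>z. f z - ?h z) = (1 / c) * NX (\<lambda>z. ((complex_of_real c * f z + f0 z) - h1 z) - (f0 z - h2 z))"
      using banach_analytic_norm_scale[OF X banach_analytic_diff[OF X D1 D2], of ?c] c by (simp add: norm_divide)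
    also have "\<dots> \<le> (1 / c) * (e * c / 2 + e * c / 2)"
      using banach_analytic_norm_diff[OF X D1 D2] h1(2) h2(2) c
      by (intro mult_left_mono) (linarith, simp)
    also have "\<dots> = e" using c by simp
    finally have "NX (\<lambda>z. f z - ?h z) \<le> e" .
    moreover have "NY ?g \<le> K * NX f"
    proof -
      have "NY ?g = (1 / c) * NY (\<lambda>z. g1 z - g2 z)"
        using banach_analytic_norm_scale[OF Y banach_analytic_diff[OF Y gY], of ?c] c by (simp add: norm_divide)
      also have "\<dots> \<le> (1 / c) * (n + n)"
        using banach_analytic_norm_diff[OF Y gY] g c by (intro mult_left_mono) auto
      also have "\<dots> = K * NX f" using pos f0 by (simp add: K_def c_def)
      finally show ?thesis .
    qed
    ultimately show ?thesis using R_scale[OF R_diff[OF g(1,3)], of ?c] by blast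
  qed
  have bound: "NY g \<le> 2 * K * NX f" if Rfg: "R f g" for f g
  proof (cases "NX f = 0")
    case True
    then show ?thesis using Rfg T0 banach_analytic_norm_eq_0[OF Y, of g] by (auto simp: R_def)
  next
    case False
    have fX: "f \<in> X" and gY: "g \<in> Y" using Rfg by (auto simp: R_def)
    define a where "a = NX f"
    have a: "a > 0" using False banach_analytic_norm_nonneg[OF X fX] by (simp add: a_def)
    \<comment> \<open>The first component is the remainder still to be approximated, the second the
      image of the part already removed. Each round halves the bound on the remainder and changes
      the image by at most \<open>K * a / 2 ^ k\<close>.\<close>
    define P where "P = (\<lambda>k (p :: (complex \<Rightarrow> complex) \<times> (complex \<Rightarrow> complex)).
        R (\<lambda>z. f z - fst p z) (snd p) \<and> fst p \<in> X \<and> NX (fst p) \<le> a / 2 ^ k \<and> (k = 0 \<longrightarrow> snd p = (\<lambda>z. 0)))"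
    define Q where "Q = (\<lambda>k (p :: (complex \<Rightarrow> complex) \<times> (complex \<Rightarrow> complex))
        (q :: (complex \<Rightarrow> complex) \<times> (complex \<Rightarrow> complex)).
        NY (\<lambda>z. snd q z - snd p z) \<le> K * a / 2 ^ k)"
    have "\<exists>p. \<forall>k. P k (p k) \<and> Q k (p k) (p (Suc k))"
    proof (rule dependent_nat_choice)
      show "\<exists>p. P 0 p"
        using R_diff[OF Rfg Rfg] fX unfolding P_def by (intro exI[of _ "(f, \<lambda>z. 0)"]) (simp add: a_def)
    next
      fix p k assume p: "P k p"
      then have u: "fst p \<in> X" "NX (fst p) \<le> a / 2 ^ k" by (auto simp: P_def)
      obtain h y where h: "R h y" "NX (\<lambda>z. fst p z - h z) \<le> a / 2 ^ Suc k" "NY y \<le> K * NX (fst p)"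
        using approx[OF u(1), of "a / 2 ^ Suc k"] a by auto
      have R': "R (\<lambda>z. f z - (fst p z - h z)) (\<lambda>z. snd p z + y z)"
        using R_diff[of "\<lambda>z. f z - fst p z" "snd p" "\<lambda>z. (-1) * h z" "\<lambda>z. (-1) * y z"] R_scale[OF h(1), of "-1"] p
        by (simp add: P_def algebra_simps)
      have "NY y \<le> K * a / 2 ^ k" using h(3) u(2) K mult_left_mono[OF u(2) K] by simp
      then show "\<exists>q. P (Suc k) q \<and> Q k p q"
        using R' h(2) banach_analytic_diff[OF X u(1)] h(1)
        by (intro exI[of _ "(\<lambda>z. fst p z - h z, \<lambda>z. snd p z + y z)"]) (auto simp: P_def Q_def R_def)
    qed
    then obtain p where p: "\<And>k. P k (p k)" "\<And>k. Q k (p k) (p (Suc k))" by blast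
    define u G where "u = (\<lambda>n. fst (p n))" and "G = (\<lambda>n. snd (p n))"
    have G: "R (\<lambda>z. f z - u k z) (G k)" "u k \<in> X" "NX (u k) \<le> a / 2 ^ k"
       "NY (\<lambda>z. G (Suc k) z - G k z) \<le> K * a / 2 ^ k" for k
      using p[of k] by (auto simp: P_def Q_def u_def G_def)
    have G0: "G 0 = (\<lambda>z. 0)" using p(1)[of 0] by (auto simp: P_def G_def)
    have GY: "G k \<in> Y" for k using G(1) by (auto simp: R_def)
    have "0 \<le> K * a" using K a by simp
    from banach_analytic_geometric_limit[OF Y, of G, OF GY this G(4)]
    obtain y where y: "y \<in> Y" "(\<lambda>n. NY (\<lambda>z. G n z - y z)) \<longlonglongrightarrow> 0"
       "\<And>n. NY (\<lambda>z. y z - G n z) \<le> 2 * (K * a) / 2 ^ n" by blast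
    \<comment> \<open>Both are limits of \<open>G k z\<close>: for \<open>y\<close> because
      evaluation is continuous on \<open>Y\<close>, for \<open>g\<close> because
      \<open>G k - g\<close> is \<open>- T (u k)\<close> on the disc and \<open>u k\<close> tends to
      0 in \<open>X\<close>.\<close>
    have "y z = g z" if z: "z \<in> ball 0 1" for z
    proof -
      obtain C where C: "\<And>h. h \<in> X \<Longrightarrow> cmod (T h z) \<le> C * NX h" using eval[OF z] by blast
      obtain D where D: "\<And>h. h \<in> Y \<Longrightarrow> cmod (h z) \<le> D * NY h"
        using banach_analytic_eval[OF Y, of "{z}"] z by auto
      have "(\<lambda>k. G k z - y z) \<longlonglongrightarrow> 0"
      proof (rule Lim_null_comparison)
        show "\<forall>\<^sub>F k in sequentially. norm (G k z - y z) \<le> D * NY (\<lambda>z. G k z - y z)"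
          using D[OF banach_analytic_diff[OF Y GY y(1)]] by simp
        show "(\<lambda>k. D * NY (\<lambda>z. G k z - y z)) \<longlonglongrightarrow> 0" using tendsto_mult_right_zero[OF y(2)] by simp
      qed
      then have "(\<lambda>k. G k z) \<longlonglongrightarrow> y z" by (simp add: LIM_zero_iff)
      moreover have "(\<lambda>k. G k z - g z) \<longlonglongrightarrow> 0"
      proof (rule Lim_null_comparison)
        have "norm (G k z - g z) \<le> \<bar>C\<bar> * (a / 2 ^ k)" for k
        proof -
          have "G k z - g z = - T (u k) z"
            using G(1)[of k] Rfg diff[OF fX G(2) z] z by (auto simp: R_def)
          then have "norm (G k z - g z) \<le> C * NX (u k)" using C[OF G(2)] by simp
          also have "\<dots> \<le> \<bar>C\<bar> * (a / 2 ^ k)"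
            using G(3)[of k] banach_analytic_norm_nonneg[OF X G(2)] by (intro mult_mono) auto
          finally show ?thesis .
        qed
        then show "\<forall>\<^sub>F k in sequentially. norm (G k z - g z) \<le> \<bar>C\<bar> * (a / 2 ^ k)" by simp
        show "(\<lambda>k. \<bar>C\<bar> * (a / 2 ^ k)) \<longlonglongrightarrow> 0" by real_asymp
      qed
      then have "(\<lambda>k. G k z) \<longlonglongrightarrow> g z" by (simp add: LIM_zero_iff)
      ultimately show ?thesis using LIMSEQ_unique by blast
    qed
    then have "NY g = NY y" using banach_analytic_norm_cong[OF Y gY y(1)] by simp
    also have "\<dots> \<le> 2 * K * a" using y(3)[of 0] by (simp add: G0)
    finally show ?thesis by (simp add: a_def)
  qed
  show ?thesis
    unfolding bounded_op_on_def using into bound unfolding R_def by blast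
qed

section \<open>Carleson measures\<close>

text \<open>For \<open>x > 1\<close> the set is all of [0,1), and the condition at
  \<open>t = 0\<close> suffices since \<open>x powr s \<ge> 1\<close>. Lifting the restriction
  \<open>x \<le> 1\<close> spares the dyadic shells below a case split near
  \<open>t = 0\<close>.\<close>

lemma carleson_measure_le:
  assumes mu: "finite_measure mu" "sets mu = sets borel" and car: "carleson mu s" and "0 \<le> s"
  obtains C where "C \<ge> 0" "\<And>x. x > 0 \<Longrightarrow> measure mu ({0..<1} \<inter> {1 - x..}) \<le> C * x powr s"
proof -
  interpret finite_measure mu by fact
  obtain C where C: "\<And>t. 0 \<le> t \<Longrightarrow> t < 1 \<Longrightarrow> measure mu {t..<1} \<le> C * (1 - t) powr s"
    using car unfolding carleson_def by blast
  have C0: "0 \<le> C" using order_trans[OF measure_nonneg C[of 0]] by simp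
  have "measure mu ({0..<1} \<inter> {1 - x..}) \<le> C * x powr s" if x: "x > 0" for x
  proof (cases "x \<le> 1")
    case True
    then have "{0..<1} \<inter> {1 - x..} = {1 - x..<1}" by auto
    then show ?thesis using C[of "1 - x"] x True by simp
  next
    case False
    then have "measure mu ({0..<1} \<inter> {1 - x..}) = measure mu {0..<1}"
      by (intro arg_cong[of _ _ "measure mu"]) auto
    also have "\<dots> \<le> C * 1" using C[of 0] by simp
    also have "\<dots> \<le> C * x powr s"
      using False \<open>0 \<le> s\<close> C0 by (intro mult_left_mono ge_one_powr_ge_zero) auto
    finally show ?thesis .
  qed
  with C0 show ?thesis using that by blast
qed

text \<open>On the shell \<open>y k \<le> 1 - t \<le> 2 * y k\<close> the integrand is at most
  \<open>y k powr - p\<close>, and the shell has mass at most \<open>C * (2 * y k) powr s\<close>.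
  Leaving the scales \<open>y\<close> free covers both shells shrinking towards 1 and shells growing
  away from it.\<close>

lemma carleson_dyadic_integral_le:
  fixes y :: "nat \<Rightarrow> real"
  assumes mu: "finite_measure mu" "sets mu = sets borel"
    and C: "C \<ge> 0" "\<And>x. x > 0 \<Longrightarrow> measure mu ({0..<1} \<inter> {1 - x..}) \<le> C * x powr s"
    and S: "S \<in> sets borel" "S \<subseteq> {0..<1}" and p: "0 \<le> p"
    and y: "\<And>k. 0 < y k" "(\<lambda>k. y k powr (s - p)) sums A"
    and cover: "\<And>t. t \<in> S \<Longrightarrow> \<exists>k. y k \<le> 1 - t \<and> 1 - t \<le> 2 * y k"
  shows "set_integrable mu S (\<lambda>t. (1 - t) powr - p)"
    and "(LINT t:S|mu. (1 - t) powr - p) \<le> C * 2 powr s * A"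
proof -
  interpret finite_measure mu by fact
  let ?E = "\<lambda>k. {0..<1} \<inter> {1 - 2 * y k..}"
  have [measurable_cong]: "sets mu = sets borel" by fact
  have [measurable]: "S \<in> sets borel" by fact
  have A0: "0 \<le> A" using sums_le[OF _ sums_zero y(2)] by simp
  \<comment> \<open>Estimating the nonnegative integral first gives integrability and the bound from
    one computation.\<close>
  have "(\<integral>\<^sup>+t. ennreal (indicator S t * (1 - t) powr - p) \<partial>mu)
      \<le> (\<integral>\<^sup>+t. (\<Sum>k. ennreal (y k powr - p) * indicator (?E k) t) \<partial>mu)"
  proof (rule nn_integral_mono)
    fix t
    show "ennreal (indicator S t * (1 - t) powr - p) \<le> (\<Sum>k. ennreal (y k powr - p) * indicator (?E k) t)"
    proof (cases "t \<in> S")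
      case True
      then obtain k where k: "y k \<le> 1 - t" "1 - t \<le> 2 * y k" using cover by blast
      have "ennreal (indicator S t * (1 - t) powr - p) \<le> ennreal (y k powr - p) * indicator (?E k) t"
        using True S k y(1)[of k] p by (auto intro!: ennreal_leI powr_mono2' simp: indicator_def)
      also have "\<dots> \<le> (\<Sum>j. ennreal (y j powr - p) * indicator (?E j) t)"
        using sum_le_suminf[of "\<lambda>j. ennreal (y j powr - p) * indicator (?E j) t" "{k}"]
        by (simp del: sum_mult_indicator)
      finally show ?thesis .
    qed simp
  qed
  also have "\<dots> = (\<Sum>k. \<integral>\<^sup>+t. ennreal (y k powr - p) * indicator (?E k) t \<partial>mu)"
    by (intro nn_integral_suminf) measurable
  also have "\<dots> \<le> (\<Sum>k. ennreal (C * 2 powr s * y k powr (s - p)))"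
  proof (intro suminf_le)
    fix k
    have "(\<integral>\<^sup>+t. ennreal (y k powr - p) * indicator (?E k) t \<partial>mu) = ennreal (y k powr - p) * emeasure mu (?E k)"
      by (subst nn_integral_cmult_indicator) auto
    also have "\<dots> = ennreal (y k powr - p * measure mu (?E k))"
      by (simp add: emeasure_eq_measure ennreal_mult)
    also have "\<dots> \<le> ennreal (y k powr - p * (C * (2 * y k) powr s))"
      using C(2)[of "2 * y k"] y(1)[of k] by (intro ennreal_leI mult_left_mono) auto
    also have "y k powr - p * (C * (2 * y k) powr s) = C * 2 powr s * y k powr (s - p)"
      using y(1)[of k] by (simp add: powr_mult powr_diff powr_minus field_simps)
    finally show "(\<integral>\<^sup>+t. ennreal (y k powr - p) * indicator (?E k) t \<partial>mu) \<le> ennreal (C * 2 powr s * y k powr (s - p))" .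
  qed auto
  also have "\<dots> = ennreal (C * 2 powr s * A)"
    using sums_mult[OF y(2), of "C * 2 powr s"] C(1)
    by (subst suminf_ennreal2) (auto simp: sums_iff)
  finally have le: "(\<integral>\<^sup>+t. ennreal (indicator S t * (1 - t) powr - p) \<partial>mu) \<le> ennreal (C * 2 powr s * A)" .
  show "set_integrable mu S (\<lambda>t. (1 - t) powr - p)"
    unfolding set_integrable_def
  proof (rule integrableI_bounded)
    show "(\<lambda>t. indicator S t *\<^sub>R (1 - t) powr - p) \<in> borel_measurable mu" by measurable
    show "(\<integral>\<^sup>+t. ennreal (norm (indicator S t *\<^sub>R (1 - t) powr - p)) \<partial>mu) < \<infinity>"
      using le_less_trans[OF le ennreal_less_top] by (simp add: abs_mult)
  qed
  show "(LINT t:S|mu. (1 - t) powr - p) \<le> C * 2 powr s * A"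
    unfolding set_lebesgue_integral_def
    using le C(1) A0 by (intro integral_real_bounded) (simp_all only: real_scaleR_def, simp)
qed

text \<open>The two families of dyadic scales: halving from \<open>c / 2\<close> towards
  \<open>t = 1\<close>, doubling from \<open>c\<close> away from it. Starting the first at
  \<open>c / 2\<close> makes its outermost shell end at \<open>c\<close>.\<close>

lemma powr_geometric_sums:
  fixes c e :: real
  assumes "0 < c" "0 < e"
  shows "(\<lambda>k. (c / 2 ^ Suc k) powr e) sums (c powr e / (2 powr e - 1))"
    and "(\<lambda>k. (c * 2 ^ k) powr - e) sums (c powr - e / (1 - 2 powr - e))"
proof -
  have q: "2 powr - e < (1::real)" using assms(2) powr_less_mono[of "-e" 0 2] by simp
  have eq: "(2 ^ k) powr - e = (2 powr - e) ^ k" for k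
    by (simp add: powr_power powr_realpow[symmetric] powr_powr mult.commute)
  have g: "(\<lambda>k. (2 powr - e) ^ k) sums (1 / (1 - 2 powr - e :: real))"
    using q by (intro geometric_sums) simp
  show "(\<lambda>k. (c * 2 ^ k) powr - e) sums (c powr - e / (1 - 2 powr - e))"
    using sums_mult[OF g, of "c powr - e"] assms by (simp add: powr_mult eq)
  have "(c / 2 ^ Suc k) powr e = (c powr e * 2 powr - e) * (2 powr - e) ^ k" for k
    using assms eq[of "Suc k"] by (simp add: powr_divide powr_minus field_simps)
  moreover have "c powr e * 2 powr - e * (1 / (1 - 2 powr - e)) = c powr e / (2 powr e - 1)"
    using assms by (simp add: powr_minus field_simps)
  ultimately show "(\<lambda>k. (c / 2 ^ Suc k) powr e) sums (c powr e / (2 powr e - 1))"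
    using sums_mult[OF g, of "c powr e * 2 powr - e"] by simp
qed

text \<open>The shells with \<open>1 - t\<close> between \<open>l / 2 ^ Suc k\<close> and
  \<open>l / 2 ^ k\<close> fill the set, and \<open>p < s\<close> makes the powers summable, with a
  sum proportional to \<open>l powr (s - p)\<close>.\<close>

lemma carleson_near_integral_le:
  assumes mu: "finite_measure mu" "sets mu = sets borel"
    and "carleson mu s" "0 \<le> p" "p < s"
  obtains C where "C \<ge> 0"
    "\<And>l. l > 0 \<Longrightarrow> set_integrable mu ({0..<1} \<inter> {1 - l..}) (\<lambda>t. (1 - t) powr - p)"
    "\<And>l. l > 0 \<Longrightarrow> (LINT t:{0..<1} \<inter> {1 - l..}|mu. (1 - t) powr - p) \<le> C * l powr (s - p)"
proof -
  from assms have "0 \<le> s" by simp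
  from carleson_measure_le[OF mu \<open>carleson mu s\<close> this] obtain C where C: "C \<ge> 0"
    "\<And>x. x > 0 \<Longrightarrow> measure mu ({0..<1} \<inter> {1 - x..}) \<le> C * x powr s" by blast
  have "\<exists>k. l / 2 ^ Suc k \<le> 1 - t \<and> 1 - t \<le> 2 * (l / 2 ^ Suc k)" if "t \<in> {0..<1} \<inter> {1 - l..}" "l > 0" for t l :: real
  proof -
    have "(\<lambda>k. l / 2 ^ Suc k) \<longlonglongrightarrow> 0" by real_asymp
    then have "\<exists>k. l / 2 ^ Suc k < 1 - t"
      using order_tendstoD(2)[of "\<lambda>k. l / 2 ^ Suc k" 0 sequentially "1 - t"] that
        eventually_happens'[of sequentially] by simp
    \<comment> \<open>Minimality supplies the upper end of the shell; for \<open>k = 0\<close> that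
      end is \<open>1 - t \<le> l\<close>.\<close>
    define k where "k = (LEAST k. l / 2 ^ Suc k < 1 - t)"
    have k: "l / 2 ^ Suc k < 1 - t" unfolding k_def by (rule LeastI_ex) fact
    moreover have "1 - t \<le> 2 * (l / 2 ^ Suc k)"
    proof (cases k)
      case 0
      then show ?thesis using that by simp
    next
      case (Suc j)
      then have "\<not> l / 2 ^ Suc j < 1 - t"
        using not_less_Least[of j "\<lambda>k. l / 2 ^ Suc k < 1 - t"] unfolding k_def[symmetric] by simp
      then show ?thesis using Suc by simp
    qed
    ultimately show ?thesis by (intro exI[of _ k]) auto
  qed
  note d = carleson_dyadic_integral_le[OF mu C _ _ \<open>0 \<le> p\<close> _ powr_geometric_sums(1) this]
  have "2 powr (s - p) > 1" using assms by simp
  then have "0 \<le> C * 2 powr s / (2 powr (s - p) - 1)"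
    using C(1) by (intro divide_nonneg_nonneg mult_nonneg_nonneg powr_ge_zero) linarith+
  then show ?thesis using assms
    by (intro that[of "C * 2 powr s / (2 powr (s - p) - 1)"] d(1) order_trans[OF d(2)]) auto
qed

text \<open>The same decomposition with doubling shells. Now \<open>s < p\<close>, so the shell
  nearest to 1 dominates.\<close>

lemma carleson_far_integral_le:
  assumes mu: "finite_measure mu" "sets mu = sets borel"
    and "carleson mu s" "0 \<le> s" "s < p"
  obtains C where "C \<ge> 0"
    "\<And>l. l > 0 \<Longrightarrow> set_integrable mu ({0..<1} \<inter> {..<1 - l}) (\<lambda>t. (1 - t) powr - p)"
    "\<And>l. l > 0 \<Longrightarrow> (LINT t:{0..<1} \<inter> {..<1 - l}|mu. (1 - t) powr - p) \<le> C * l powr (s - p)"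
proof -
  from assms have "0 \<le> p" by simp
  from carleson_measure_le[OF mu \<open>carleson mu s\<close> \<open>0 \<le> s\<close>] obtain C where C: "C \<ge> 0"
    "\<And>x. x > 0 \<Longrightarrow> measure mu ({0..<1} \<inter> {1 - x..}) \<le> C * x powr s" by blast
  have cov: "\<exists>k. l * 2 ^ k \<le> 1 - t \<and> 1 - t \<le> 2 * (l * 2 ^ k)" if "t \<in> {0..<1} \<inter> {..<1 - l}" "l > 0" for t l :: real
  proof -
    have "filterlim (\<lambda>k. l * 2 ^ Suc k) at_top sequentially" using that by real_asymp
    then have "\<exists>k. 1 - t \<le> l * 2 ^ Suc k"
      by (auto simp: filterlim_at_top eventually_sequentially)
    define k where "k = (LEAST k. 1 - t \<le> l * 2 ^ Suc k)"
    have k: "1 - t \<le> l * 2 ^ Suc k" unfolding k_def by (rule LeastI_ex) fact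
    moreover have "l * 2 ^ k \<le> 1 - t"
    proof (cases k)
      case 0
      then show ?thesis using that by simp
    next
      case (Suc j)
      then have "\<not> 1 - t \<le> l * 2 ^ Suc j"
        using not_less_Least[of j "\<lambda>k. 1 - t \<le> l * 2 ^ Suc k"] unfolding k_def[symmetric] by simp
      then show ?thesis using Suc by simp
    qed
    ultimately show ?thesis by (intro exI[of _ k]) auto
  qed
  have "0 < p - s" using assms by simp
  note sm = powr_geometric_sums(2)[OF _ this, unfolded minus_diff_eq]
  note d = carleson_dyadic_integral_le[OF mu C _ _ \<open>0 \<le> p\<close> _ sm cov]
  have "2 powr (s - p) < 1" using assms powr_less_mono[of "s - p" 0 2] by simp
  then show ?thesis using assms C(1)
    by (intro that[of "C * 2 powr s / (1 - 2 powr (s - p))"] d(1) order_trans[OF d(2)]) auto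
qed

section \<open>Morrey spaces\<close>

text \<open>The estimate is uniform in the centre \<open>c\<close>, which may lie anywhere. At
  distance at least \<open>l\<close> from \<open>c\<close> the integrand is at most
  \<open>l powr - k\<close>; the remaining points lie in two intervals of length \<open>l\<close>
  touching \<open>c\<close>.\<close>

lemma nn_integral_abs_powr_le:
  fixes k :: real
  assumes k: "0 \<le> k" "k < 1" and l: "l > 0"
  shows "(\<integral>\<^sup>+x\<in>{a..a+l}. ennreal (\<bar>x - c\<bar> powr - k) \<partial>lborel)
      \<le> ennreal ((1 + 2 / (1 - k)) * l powr (1 - k))"
proof -
  define h where "h = (\<lambda>x. ennreal (x powr - k) * indicator {0..l} x)"
  have [measurable]: "h \<in> borel_measurable borel" unfolding h_def by measurable
  have "((\<lambda>x. x powr - k) has_integral (l powr (- k + 1) / (- k + 1))) {0..l}"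
    using k l by (intro has_integral_powr_from_0) auto
  from nn_integral_has_integral_lebesgue'[OF _ this]
  have half: "integral\<^sup>N lborel h = ennreal (l powr (1 - k) / (1 - k))"
    by (simp add: h_def)
  have "(\<integral>\<^sup>+x\<in>{a..a+l}. ennreal (\<bar>x - c\<bar> powr - k) \<partial>lborel)
      \<le> (\<integral>\<^sup>+x. ennreal (l powr - k) * indicator {a..a+l} x + (h (- c + 1 * x) + h (c + (-1) * x)) \<partial>lborel)"
  proof (rule nn_integral_mono)
    fix x
    consider "l \<le> \<bar>x - c\<bar>" | "0 \<le> x - c" "x - c \<le> l" | "x - c < 0" "c - x \<le> l" by linarith
    then show "ennreal (\<bar>x - c\<bar> powr - k) * indicator {a..a+l} x
        \<le> ennreal (l powr - k) * indicator {a..a+l} x + (h (- c + 1 * x) + h (c + (-1) * x))"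
    proof cases
      case 1
      then have "ennreal (\<bar>x - c\<bar> powr - k) \<le> ennreal (l powr - k)"
        using k l by (intro ennreal_leI powr_mono2') auto
      then show ?thesis by (simp add: add_increasing2 mult_right_mono)
    next
      case 2
      then have "ennreal (\<bar>x - c\<bar> powr - k) * indicator {a..a+l} x \<le> h (- c + 1 * x)"
        by (simp add: h_def indicator_def)
      then show ?thesis by (simp add: add_increasing add_increasing2)
    next
      case 3
      then have "ennreal (\<bar>x - c\<bar> powr - k) * indicator {a..a+l} x \<le> h (c + (-1) * x)"
        by (simp add: h_def indicator_def)
      then show ?thesis by (simp add: add_increasing)
    qed
  qed
  also have "\<dots> = ennreal (l powr - k) * ennreal l + (integral\<^sup>N lborel h + integral\<^sup>N lborel h)"
    using nn_integral_real_affine[of h 1 "-c"] nn_integral_real_affine[of h "-1" c] l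
    by (simp add: nn_integral_add nn_integral_cmult_indicator)
  also have "\<dots> = ennreal (l powr - k * l + 2 * (l powr (1 - k) / (1 - k)))"
    using k l by (simp add: half ennreal_plus[symmetric] ennreal_mult[symmetric] del: ennreal_plus)
  also have "l powr - k * l + 2 * (l powr (1 - k) / (1 - k)) = (1 + 2 / (1 - k)) * l powr (1 - k)"
  proof -
    have "l powr - k * l = l powr (1 - k)" using l by (simp add: powr_diff powr_minus field_simps)
    then show ?thesis by (simp add: distrib_right)
  qed
  finally show ?thesis .
qed

section \<open>Distance from 1 to points of the circle, and its singular integrals\<close>

lemma cmod_one_minus_cis: "cmod (1 - cis x) = 2 * \<bar>sin (x / 2)\<bar>"
  using dist_exp_i_1[of x] by (simp add: cis_conv_exp norm_minus_commute)

text \<open>Jordan's inequality: the concave sine lies above its chord on the first quarter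
  period.\<close>

lemma cmod_one_minus_cis_ge:
  assumes "\<bar>x\<bar> \<le> pi"
  shows "2 / pi * \<bar>x\<bar> \<le> cmod (1 - cis x)"
proof -
  define y where "y = \<bar>x\<bar> / 2"
  have y: "0 \<le> y" "y \<le> pi / 2" using assms by (auto simp: y_def)
  have "convex_on {0..pi / 2} (\<lambda>x. - sin x)"
    by (rule f''_ge0_imp_convex[where f' = "\<lambda>x. - cos x" and f'' = sin])
      (auto intro!: derivative_eq_intros sin_ge_zero)
  from convex_onD_Icc'[OF this, of y] have "2 / pi * y \<le> sin y" using y by simp
  also have "sin y = \<bar>sin (x / 2)\<bar>"
    using sin_ge_zero[of y] y by (cases "x \<ge> 0") (auto simp: y_def)
  finally show ?thesis by (simp add: cmod_one_minus_cis y_def)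
qed

lemma cmod_cis_diff_le: "cmod (cis x - cis y) \<le> \<bar>x - y\<bar>"
proof -
  have "cis x - cis y = - (cis y * (1 - cis (x - y)))" by (simp add: cis_mult algebra_simps)
  then have "cmod (cis x - cis y) = 2 * \<bar>sin ((x - y) / 2)\<bar>"
    by (simp add: norm_mult cmod_one_minus_cis)
  also have "\<dots> \<le> \<bar>x - y\<bar>" using abs_sin_x_le_abs_x[of "(x - y) / 2"] by simp
  finally show ?thesis .
qed

text \<open>By Jordan's inequality the integrand is bounded by a power of the distance to a multiple
  of \<open>2 * pi\<close>. Every point of an arc of length at most \<open>2 * pi\<close> is within
  \<open>pi\<close> of one of two consecutive multiples, so two singular integrals suffice, whatever
  \<open>a\<close> is.\<close>

lemma nn_integral_cis_powr_le:
  fixes k :: real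
  assumes k: "0 \<le> k" "k < 1"
  obtains C where "C \<ge> 0" "\<And>a l. 0 < l \<Longrightarrow> l \<le> 2 * pi \<Longrightarrow>
    (\<integral>\<^sup>+x\<in>{a..a+l}. ennreal (cmod (1 - cis x) powr - k) \<partial>lborel) \<le> ennreal (C * l powr (1 - k))"
proof
  let ?D = "(1 + 2 / (1 - k))" and ?q = "(2 / pi) powr - k"
  show "0 \<le> ?q * (2 * ?D)" using k by simp
  fix a l :: real assume l: "0 < l" "l \<le> 2 * pi"
  \<comment> \<open>\<open>c\<close> is the multiple of \<open>2 * pi\<close> with
    \<open>c - pi \<le> a < c + pi\<close>, and \<open>d\<close> is the next one, so
    \<open>a + l \<le> d + pi\<close>.\<close>
  define n where "n = \<lfloor>(a + pi) / (2 * pi)\<rfloor>"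
  define c d where "c = 2 * pi * of_int n" and "d = 2 * pi * of_int (n + 1)"
  have "of_int n \<le> (a + pi) / (2 * pi)" "(a + pi) / (2 * pi) < of_int n + 1"
    unfolding n_def by linarith+
  then have cd: "c - pi \<le> a" "a < c + pi" "d = c + 2 * pi"
    by (auto simp: c_def d_def field_simps)
  have per: "cis (x - c) = cis x" "cis (x - d) = cis x" for x
    by (simp_all add: c_def d_def flip: cis_divide)
  have "(\<integral>\<^sup>+x\<in>{a..a+l}. ennreal (cmod (1 - cis x) powr - k) \<partial>lborel)
     \<le> (\<integral>\<^sup>+x. ennreal ?q * (ennreal (\<bar>x - c\<bar> powr - k) * indicator {a..a+l} x
             + ennreal (\<bar>x - d\<bar> powr - k) * indicator {a..a+l} x) \<partial>lborel)"
  proof (rule nn_integral_mono)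
    fix x
    have key: "cmod (1 - cis x) powr - k \<le> ?q * \<bar>x - e\<bar> powr - k"
      if "\<bar>x - e\<bar> \<le> pi" "cis (x - e) = cis x" for e
    proof (cases "x = e")
      \<comment> \<open>Here \<open>cis x = 1\<close> and both sides are 0, since
        \<open>0 powr - k = 0\<close>.\<close>
      case True
      then show ?thesis using that(2)[symmetric] by simp
    next
      case False
      have "cmod (1 - cis x) powr - k \<le> (2 / pi * \<bar>x - e\<bar>) powr - k"
        using cmod_one_minus_cis_ge[OF that(1)] False k that(2) by (intro powr_mono2') auto
      also have "\<dots> = ?q * \<bar>x - e\<bar> powr - k" by (rule powr_mult)
      finally show ?thesis .
    qed
    show "ennreal (cmod (1 - cis x) powr - k) * indicator {a..a+l} x
      \<le> ennreal ?q * (ennreal (\<bar>x - c\<bar> powr - k) * indicator {a..a+l} x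
             + ennreal (\<bar>x - d\<bar> powr - k) * indicator {a..a+l} x)"
    proof (cases "x \<in> {a..a+l}")
      case True
      then have "\<bar>x - c\<bar> \<le> pi \<or> \<bar>x - d\<bar> \<le> pi" using cd l by auto
      then have "cmod (1 - cis x) powr - k \<le> ?q * (\<bar>x - c\<bar> powr - k + \<bar>x - d\<bar> powr - k)"
        using key[OF _ per(1)] key[OF _ per(2)]
        by (smt (verit) distrib_left mult_nonneg_nonneg powr_ge_zero)
      from ennreal_leI[OF this] show ?thesis using True by (simp add: ennreal_mult)
    qed simp
  qed
  also have "\<dots> = ennreal ?q * ((\<integral>\<^sup>+x\<in>{a..a+l}. ennreal (\<bar>x - c\<bar> powr - k) \<partial>lborel)
      + (\<integral>\<^sup>+x\<in>{a..a+l}. ennreal (\<bar>x - d\<bar> powr - k) \<partial>lborel))"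
    by (subst nn_integral_cmult, measurable, subst nn_integral_add) measurable
  also have "\<dots> \<le> ennreal ?q * (ennreal (?D * l powr (1 - k)) + ennreal (?D * l powr (1 - k)))"
    using nn_integral_abs_powr_le[OF k l(1)] by (intro mult_left_mono add_mono) auto
  also have "\<dots> = ennreal (?q * (2 * ?D) * l powr (1 - k))"
    using k by (simp add: algebra_simps flip: ennreal_plus ennreal_mult)
  finally show "(\<integral>\<^sup>+x\<in>{a..a+l}. ennreal (cmod (1 - cis x) powr - k) \<partial>lborel)
     \<le> ennreal (?q * (2 * ?D) * l powr (1 - k))" .
qed

text \<open>Expanding the square, the left side is the right side minus
  \<open>l * (cmod m)\<^sup>2\<close>, where \<open>m\<close> is the mean.\<close>

lemma integral_diff_mean_square_le:
  fixes u :: "'a \<Rightarrow> complex"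
  assumes "finite_measure M" "integrable M u" "integrable M (\<lambda>x. (cmod (u x))\<^sup>2)"
    and l: "measure M (space M) = l" "l > 0"
  shows "(\<integral>x. (cmod (u x - (\<integral>y. u y \<partial>M) / complex_of_real l))\<^sup>2 \<partial>M) \<le> (\<integral>x. (cmod (u x))\<^sup>2 \<partial>M)"
proof -
  interpret finite_measure M by fact
  define m where "m = (\<integral>y. u y \<partial>M) / complex_of_real l"
  have lm: "(\<integral>y. u y \<partial>M) = l *\<^sub>R m" using l by (simp add: m_def scaleR_conv_of_real)
  have "(\<integral>x. (cmod (u x - m))\<^sup>2 \<partial>M) = (\<integral>x. (cmod (u x))\<^sup>2 - 2 * (u x \<bullet> m) + (cmod m)\<^sup>2 \<partial>M)"
    by (simp add: power2_norm_eq_inner inner_diff inner_commute algebra_simps)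
  also have "\<dots> = (\<integral>x. (cmod (u x))\<^sup>2 \<partial>M) - 2 * ((\<integral>y. u y \<partial>M) \<bullet> m) + l * (cmod m)\<^sup>2"
    using assms by simp
  also have "\<dots> = (\<integral>x. (cmod (u x))\<^sup>2 \<partial>M) - l * (cmod m)\<^sup>2"
    by (simp add: lm power2_norm_eq_inner)
  finally show ?thesis using l by (simp add: m_def)
qed

text \<open>The mean over an arc minimises the mean-square deviation, so any constant
  \<open>c\<close>, chosen separately for each arc, may replace it. The bound is on a nonnegative
  integral because it then also makes the boundary function integrable on the arc.\<close>

lemma morreyI:
  assumes "f \<in> hardy2" and meas: "boundary_fun f \<in> borel_measurable borel" and "K \<ge> 0"
    and osc: "\<And>a l. 0 < l \<Longrightarrow> l \<le> 2 * pi \<Longrightarrow> \<exists>c. (\<integral>\<^sup>+x\<in>{a..a+l}. ennreal ((cmod (boundary_fun f x - c))\<^sup>2) \<partial>lborel)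
        \<le> ennreal (K * l powr lam)"
  shows "f \<in> morrey lam"
proof -
  note [measurable] = meas
  have "sqrt ((1 / l powr lam) * (LBINT \<theta>=a..a+l. (cmod (boundary_fun f \<theta> - arc_mean f a l))\<^sup>2)) \<le> sqrt K"
    if l: "0 < l" "l \<le> 2 * pi" for a l
  proof -
    obtain c where c: "(\<integral>\<^sup>+x\<in>{a..a+l}. ennreal ((cmod (boundary_fun f x - c))\<^sup>2) \<partial>lborel) \<le> ennreal (K * l powr lam)"
      using osc[OF l] by blast
    define M where "M = restrict_space lborel {a..a+l}"
    have M_int: "(\<integral>x. g x \<partial>M) = (LBINT x:{a..a+l}. g x)" for g :: "real \<Rightarrow> 'b::{banach,second_countable_topology}"
      unfolding M_def set_lebesgue_integral_def by (subst integral_restrict_space) auto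
    have M: "finite_measure M" "measure M (space M) = l"
      using l by (auto simp: M_def space_restrict_space measure_restrict_space emeasure_restrict_space
          intro!: finite_measureI)
    interpret finite_measure M by fact
    define u where "u = (\<lambda>x. boundary_fun f x - c)"
    have [measurable]: "u \<in> borel_measurable borel" by (simp add: u_def)
    have um[measurable]: "u \<in> borel_measurable M" unfolding M_def by (intro measurable_restrict_space1) simp
    have nn: "(\<integral>\<^sup>+x. ennreal ((cmod (u x))\<^sup>2) \<partial>M) \<le> ennreal (K * l powr lam)"
      using c unfolding M_def u_def by (subst nn_integral_restrict_space) auto
    have u2: "integrable M (\<lambda>x. (cmod (u x))\<^sup>2)"
      using nn by (intro integrableI_bounded) (auto intro: le_less_trans)
    have u1: "integrable M u"
    proof (rule Bochner_Integration.integrable_bound)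
      show "integrable M (\<lambda>x. 1 + (cmod (u x))\<^sup>2)" using u2 by simp
      have "cmod (u x) \<le> 1 + (cmod (u x))\<^sup>2" for x
        using zero_le_power2[of "cmod (u x) - 1"] by (simp add: power2_eq_square algebra_simps) (smt (verit) norm_ge_zero zero_le_square)
      then show "AE x in M. norm (u x) \<le> norm (1 + (cmod (u x))\<^sup>2)" by (auto intro!: AE_I2 intro: order_trans)
    qed simp
    have "arc_mean f a l = (\<integral>x. u x + c \<partial>M) / complex_of_real l"
      unfolding arc_mean_def M_int u_def using l by (subst interval_integral_Icc) (auto simp: set_lebesgue_integral_def)
    also have "\<dots> = (\<integral>x. u x \<partial>M) / complex_of_real l + c"
      using u1 M(2) l by (simp add: scaleR_conv_of_real field_simps)
    finally have mean: "boundary_fun f x - arc_mean f a l = u x - (\<integral>x. u x \<partial>M) / complex_of_real l" for x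
      by (simp add: u_def)
    have "(LBINT \<theta>=a..a+l. (cmod (boundary_fun f \<theta> - arc_mean f a l))\<^sup>2) =
        (\<integral>x. (cmod (u x - (\<integral>y. u y \<partial>M) / complex_of_real l))\<^sup>2 \<partial>M)"
      using l by (subst interval_integral_Icc) (auto simp: M_int mean)
    also have "\<dots> \<le> (\<integral>x. (cmod (u x))\<^sup>2 \<partial>M)"
      using integral_diff_mean_square_le[OF M(1) u1 u2 M(2) l(1)] .
    also have "\<dots> \<le> K * l powr lam"
      using nn \<open>K \<ge> 0\<close> by (intro integral_real_bounded) auto
    finally have "(1 / l powr lam) * (LBINT \<theta>=a..a+l. (cmod (boundary_fun f \<theta> - arc_mean f a l))\<^sup>2) \<le> K"
      using l by (simp add: field_simps)
    then show ?thesis by simp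
  qed
  then show ?thesis using assms(1) unfolding morrey_def by blast
qed

section \<open>Boundary values of functions dominated by a power of the distance to 1\<close>

lemma powr_squared: "(y powr a)\<^sup>2 = y powr (2 * a)" for a y :: real
  by (simp add: power2_eq_square flip: powr_add)

lemma borel_measurable_cis [measurable]: "cis \<in> borel_measurable borel"
  by (intro borel_measurable_continuous_onI continuous_intros)

lemma AE_cis_neq_1: "AE x in lborel. cis x \<noteq> 1"
  and countable_cis_eq_1: "countable {x. cis x = 1}"
proof -
  have "{x. cis x = 1} \<subseteq> range (\<lambda>n::int. of_int n * 2 * pi)"
    using cos_one_2pi_int by (auto simp: complex_eq_iff)
  then show c: "countable {x. cis x = 1}" by (rule countable_subset) simp
  show "AE x in lborel. cis x \<noteq> 1"
    using AE_not_in[OF countable_imp_null_set_lborel[OF c]] by simp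
qed

text \<open>The distance from \<open>r * cis x\<close> to \<open>cis x\<close> is
  \<open>1 - r\<close>, which is at most its distance to 1. Bounds in terms of
  \<open>cmod (1 - cis x)\<close> thus become uniform along the radius.\<close>

lemma cmod_one_minus_cis_radial_le:
  assumes "0 \<le> r" "r \<le> 1"
  shows "cmod (1 - cis x) \<le> 2 * cmod (1 - complex_of_real r * cis x)"
proof -
  have "cmod (1 - cis x) \<le> cmod (1 - complex_of_real r * cis x) + cmod (complex_of_real r * cis x - cis x)"
    using norm_triangle_ineq[of "1 - complex_of_real r * cis x" "complex_of_real r * cis x - cis x"] by simp
  also have "complex_of_real r * cis x - cis x = - (complex_of_real (1 - r) * cis x)" by (simp add: algebra_simps)
  then have "cmod (complex_of_real r * cis x - cis x) = 1 - r" using assms by (simp add: norm_mult del: of_real_diff)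
  also have "1 - r \<le> cmod (1 - complex_of_real r * cis x)"
    using norm_triangle_ineq2[of 1 "complex_of_real r * cis x"] assms by (simp add: norm_mult)
  finally show ?thesis by simp
qed

text \<open>The majorant is independent of \<open>r\<close>, and its square is integrable over the
  circle because \<open>2 * g < 1\<close>.\<close>

lemma hardy2I:
  assumes hol: "f holomorphic_on ball 0 1" and g: "0 \<le> g" "g < 1 / 2"
    and le: "\<And>r x. 0 \<le> r \<Longrightarrow> r < 1 \<Longrightarrow> cis x \<noteq> 1 \<Longrightarrow>
      cmod (f (complex_of_real r * cis x)) \<le> D * cmod (1 - cis x) powr - g"
  shows "f \<in> hardy2"
proof -
  obtain C where C: "C \<ge> 0" "\<And>a l. 0 < l \<Longrightarrow> l \<le> 2 * pi \<Longrightarrow>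
    (\<integral>\<^sup>+x\<in>{a..a+l}. ennreal (cmod (1 - cis x) powr - (2 * g)) \<partial>lborel) \<le> ennreal (C * l powr (1 - 2 * g))"
    using nn_integral_cis_powr_le[of "2 * g"] g by auto
  have "(LBINT \<theta>=0..2*pi. (cmod (f (complex_of_real r * cis \<theta>)))\<^sup>2) \<le> D\<^sup>2 * (C * (2 * pi) powr (1 - 2 * g))"
    if r: "0 \<le> r" "r < 1" for r
  proof -
    have "(\<integral>\<^sup>+x. ennreal (indicator {0..2*pi} x * (cmod (f (complex_of_real r * cis x)))\<^sup>2) \<partial>lborel)
      \<le> (\<integral>\<^sup>+x. ennreal (D\<^sup>2) * (ennreal (cmod (1 - cis x) powr - (2 * g)) * indicator {0..2*pi} x) \<partial>lborel)"
    proof (rule nn_integral_mono_AE)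
      show "AE x in lborel. ennreal (indicator {0..2*pi} x * (cmod (f (complex_of_real r * cis x)))\<^sup>2)
          \<le> ennreal (D\<^sup>2) * (ennreal (cmod (1 - cis x) powr - (2 * g)) * indicator {0..2*pi} x)"
        using AE_cis_neq_1
      proof eventually_elim
        case (elim x)
        have "(cmod (f (complex_of_real r * cis x)))\<^sup>2 \<le> (D * cmod (1 - cis x) powr - g)\<^sup>2"
          using le[OF r elim] by (intro power_mono) auto
        also have "\<dots> = D\<^sup>2 * cmod (1 - cis x) powr - (2 * g)"
          by (simp add: power_mult_distrib powr_squared)
        finally have "ennreal ((cmod (f (complex_of_real r * cis x)))\<^sup>2) \<le> ennreal (D\<^sup>2) * ennreal (cmod (1 - cis x) powr - (2 * g))"
          by (simp add: ennreal_leI flip: ennreal_mult)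
        then show ?case by (simp add: indicator_def)
      qed
    qed
    also have "\<dots> = ennreal (D\<^sup>2) * (\<integral>\<^sup>+x\<in>{0..2*pi}. ennreal (cmod (1 - cis x) powr - (2 * g)) \<partial>lborel)"
      by (rule nn_integral_cmult) measurable
    also have "\<dots> \<le> ennreal (D\<^sup>2) * ennreal (C * (2 * pi) powr (1 - 2 * g))"
      using C(2)[of "2 * pi" 0] by (intro mult_left_mono) auto
    also have "\<dots> = ennreal (D\<^sup>2 * (C * (2 * pi) powr (1 - 2 * g)))" using C(1) by (simp add: ennreal_mult)
    finally have "(\<integral>x. indicator {0..2*pi} x * (cmod (f (complex_of_real r * cis x)))\<^sup>2 \<partial>lborel) \<le> D\<^sup>2 * (C * (2 * pi) powr (1 - 2 * g))"
      using C(1) by (intro integral_real_bounded) auto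
    then show ?thesis
      using interval_integral_Icc[of 0 "2 * pi" "\<lambda>x. (cmod (f (complex_of_real r * cis x)))\<^sup>2"]
      by (simp add: set_lebesgue_integral_def zero_ereal_def)
  qed
  then show ?thesis unfolding hardy2_def using hol by blast
qed

lemma boundary_fun_eqI:
  "((\<lambda>r. f (complex_of_real r * cis x)) \<longlongrightarrow> L) (at_left 1) \<Longrightarrow> boundary_fun f x = L"
  unfolding boundary_fun_def by (intro tendsto_Lim) auto

text \<open>\<open>boundary_fun\<close> is a \<open>Lim\<close>, about which nothing is known where
  \<open>cis x = 1\<close>. Off that countable set it is a sequential limit of functions continuous
  in the angle, and changes on a countable set preserve Borel measurability.\<close>

lemma boundary_fun_measurable:
  assumes hol: "f holomorphic_on ball 0 1"
    and L: "\<And>x. cis x \<noteq> 1 \<Longrightarrow> ((\<lambda>r. f (complex_of_real r * cis x)) \<longlongrightarrow> L x) (at_left 1)"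
  shows "boundary_fun f \<in> borel_measurable borel"
proof -
  let ?r = "\<lambda>n. 1 - 1 / real (n + 2)"
  let ?G = "\<lambda>x. if cis x = 1 then 0 else L x"
  let ?g = "\<lambda>n x. if cis x = 1 then 0 else f (complex_of_real (?r n) * cis x)"
  have [measurable]: "(\<lambda>x. f (complex_of_real (?r n) * cis x)) \<in> borel_measurable borel" for n
  proof (intro borel_measurable_continuous_onI continuous_on_compose2[OF holomorphic_on_imp_continuous_on[OF hol]])
    have "\<bar>?r n\<bar> < 1" by (simp add: abs_less_iff field_simps)
    then show "range (\<lambda>x. complex_of_real (?r n) * cis x) \<subseteq> ball 0 1"
      by (auto simp: norm_mult simp del: of_real_diff of_real_divide)
  qed (intro continuous_intros)
  have rl: "filterlim ?r (at_left 1) sequentially"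
    unfolding filterlim_at_split by (auto simp: filterlim_at) real_asymp
  have "?G \<in> borel_measurable borel"
  proof (rule borel_measurable_LIMSEQ_metric)
    show "?g n \<in> borel_measurable borel" for n by measurable
    show "(\<lambda>n. ?g n x) \<longlonglongrightarrow> ?G x" for x
      using filterlim_compose[OF L rl, of x] by (cases "cis x = 1") auto
  qed
  then show ?thesis
    by (rule measurable_discrete_difference[OF _ countable_cis_eq_1])
      (auto simp: boundary_fun_eqI[OF L])
qed

lemma one_minus_not_nonpos_Reals: "cmod z \<le> 1 \<Longrightarrow> z \<noteq> 1 \<Longrightarrow> 1 - z \<notin> \<real>\<^sub>\<le>\<^sub>0"
proof
  assume z: "cmod z \<le> 1" "z \<noteq> 1" "1 - z \<in> \<real>\<^sub>\<le>\<^sub>0"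
  then have "Im z = 0" "Re z \<ge> 1" by (auto simp: complex_nonpos_Reals_iff)
  then show False using z abs_Re_le_cmod[of z] by (auto simp: complex_eq_iff)
qed

lemma cmod_powr_of_real: "w \<noteq> 0 \<Longrightarrow> cmod (w powr complex_of_real b) = cmod w powr b"
  by (simp add: powr_def)

text \<open>The test function for necessity. The constant 0 is good enough on every arc: the squared
  modulus of the boundary function is \<open>cmod (1 - cis x) powr - (2 * b)\<close>, with integral
  at most of order \<open>l powr (1 - 2 * b)\<close>, and \<open>1 - 2 * b = lam\<close>.\<close>

lemma one_minus_powr_in_morrey:
  assumes "0 < lam" "lam < 1" and b: "b = (1 - lam) / 2"
  shows "(\<lambda>z. (1 - z) powr complex_of_real (- b)) \<in> morrey lam" (is "?F \<in> _")
proof -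
  have bb: "0 \<le> b" "b < 1 / 2" using assms by auto
  have hol: "?F holomorphic_on ball 0 1"
    by (intro holomorphic_intros one_minus_not_nonpos_Reals) auto
  have size: "cmod (?F (complex_of_real r * cis x)) \<le> 2 powr b * cmod (1 - cis x) powr - b"
    if "0 \<le> r" "r \<le> 1" "cis x \<noteq> 1" for r x
  proof -
    let ?w = "1 - complex_of_real r * cis x"
    have pos: "0 < cmod (1 - cis x) / 2" using that by simp
    also have le: "cmod (1 - cis x) / 2 \<le> cmod ?w" using cmod_one_minus_cis_radial_le[OF that(1,2), of x] by simp
    finally have "?w \<noteq> 0" by auto
    then have "cmod (?F (complex_of_real r * cis x)) = cmod ?w powr - b" by (rule cmod_powr_of_real)
    also have "\<dots> \<le> (cmod (1 - cis x) / 2) powr - b" using le pos bb by (intro powr_mono2') auto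
    also have "\<dots> = 2 powr b * cmod (1 - cis x) powr - b" by (simp add: powr_divide powr_minus field_simps)
    finally show ?thesis .
  qed
  have lim: "((\<lambda>r. ?F (complex_of_real r * cis x)) \<longlongrightarrow> ?F (cis x)) (at_left 1)" if "cis x \<noteq> 1" for x
  proof -
    have "1 - cis x \<notin> \<real>\<^sub>\<le>\<^sub>0" using one_minus_not_nonpos_Reals[of "cis x"] that by simp
    then have "isCont ?F (complex_of_real 1 * cis x)" by (intro continuous_intros) auto
    then have "isCont (\<lambda>r. ?F (complex_of_real r * cis x)) 1"
      by (rule isCont_o2[rotated]) (intro continuous_intros)
    then show ?thesis by (simp add: isCont_def filterlim_at_split)
  qed
  obtain C where C: "C \<ge> 0" "\<And>a l. 0 < l \<Longrightarrow> l \<le> 2 * pi \<Longrightarrow>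
    (\<integral>\<^sup>+x\<in>{a..a+l}. ennreal (cmod (1 - cis x) powr - (2 * b)) \<partial>lborel) \<le> ennreal (C * l powr (1 - 2 * b))"
    using nn_integral_cis_powr_le[of "2 * b"] bb by auto
  show ?thesis
  proof (rule morreyI)
    show "?F \<in> hardy2" by (rule hardy2I[OF hol bb size]) auto
    show "boundary_fun ?F \<in> borel_measurable borel" using boundary_fun_measurable[OF hol lim] .
    show "0 \<le> C" by fact
    fix a l :: real assume l: "0 < l" "l \<le> 2 * pi"
    have "(\<integral>\<^sup>+x\<in>{a..a+l}. ennreal ((cmod (boundary_fun ?F x - 0))\<^sup>2) \<partial>lborel)
        = (\<integral>\<^sup>+x\<in>{a..a+l}. ennreal (cmod (1 - cis x) powr - (2 * b)) \<partial>lborel)"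
    proof (rule nn_integral_cong_AE)
      show "AE x in lborel. ennreal ((cmod (boundary_fun ?F x - 0))\<^sup>2) * indicator {a..a+l} x
          = ennreal (cmod (1 - cis x) powr - (2 * b)) * indicator {a..a+l} x"
        using AE_cis_neq_1
      proof eventually_elim
        case (elim x)
        have "cmod (boundary_fun ?F x) = cmod (1 - cis x) powr - b"
          using boundary_fun_eqI[OF lim[OF elim]] elim cmod_powr_of_real[of "1 - cis x" "- b"] by simp
        then show ?case by (simp add: powr_squared)
      qed
    qed
    also have "\<dots> \<le> ennreal (C * l powr (1 - 2 * b))" by (rule C(2)[OF l])
    also have "1 - 2 * b = lam" by (simp add: b field_simps)
    finally show "\<exists>c. (\<integral>\<^sup>+x\<in>{a..a+l}. ennreal ((cmod (boundary_fun ?F x - c))\<^sup>2) \<partial>lborel) \<le> ennreal (C * l powr lam)" ..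
  qed
qed

section \<open>The Cesaro-type operator\<close>

text \<open>Integrating the derivative bound along the segment from 0 to \<open>z\<close> lowers the
  exponent by one. The sum of the constants serves for both estimates.\<close>

lemma bloch_type_growth:
  assumes f: "f \<in> bloch_type (b + 1)" and b: "b > 0"
  obtains M where "M \<ge> 0"
    "\<And>z. z \<in> ball 0 1 \<Longrightarrow> cmod (f z) \<le> M * (1 - cmod z) powr - b"
    "\<And>z. z \<in> ball 0 1 \<Longrightarrow> cmod (deriv f z) \<le> M * (1 - cmod z) powr - (b + 1)"
proof -
  have hol: "f holomorphic_on ball 0 1" using f by (simp add: bloch_type_def)
  obtain M0 where M0: "\<And>z. z \<in> ball 0 1 \<Longrightarrow> (1 - (cmod z)\<^sup>2) powr (b + 1) * cmod (deriv f z) \<le> M0"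
    using f unfolding bloch_type_def by blast
  define M where "M = max 0 M0"
  have M: "M \<ge> 0" by (simp add: M_def)
  have der: "cmod (deriv f z) \<le> M * (1 - cmod z) powr - (b + 1)" if z: "z \<in> ball 0 1" for z
  proof -
    have sq: "(cmod z)\<^sup>2 \<le> cmod z" using z power_decreasing[of 1 2 "cmod z"] by simp
    have "(1 - cmod z) powr (b + 1) * cmod (deriv f z) \<le> (1 - (cmod z)\<^sup>2) powr (b + 1) * cmod (deriv f z)"
      using sq z b by (intro mult_right_mono powr_mono2) auto
    also have "\<dots> \<le> M" using M0[OF z] by (simp add: M_def)
    finally show ?thesis using z by (simp only: powr_minus) (simp add: field_simps)
  qed
  have size: "cmod (f z) \<le> (cmod (f 0) + M / b) * (1 - cmod z) powr - b" if z: "z \<in> ball 0 1" for z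
  proof -
    have xz: "complex_of_real x * z \<in> ball 0 1" if "0 \<le> x" "x \<le> 1" for x
      using z that mult_left_le_one_le[of "cmod z" x] by (simp add: norm_mult)
    have xz': "1 - x * cmod z > 0" if "0 \<le> x" "x \<le> 1" for x
      using xz[OF that] that by (simp add: norm_mult)
    have fd: "(f has_field_derivative deriv f w) (at w)" if "w \<in> ball 0 1" for w
      using holomorphic_derivI[OF hol _ that] by simp
    \<comment> \<open>A primitive of the majorant of the derivative of \<open>f\<close> along the
      segment to \<open>z\<close>.\<close>
    define \<phi> where "\<phi> = (\<lambda>x. M / b * (1 - x * cmod z) powr - b)"
    have "norm ((f \<circ> (\<lambda>x. complex_of_real x * z)) 1 - (f \<circ> (\<lambda>x. complex_of_real x * z)) 0) \<le> \<phi> 1 - \<phi> 0"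
    proof (rule differentiable_bound_general)
      have vd: "((\<lambda>x. complex_of_real x * z) has_vector_derivative z) (at x)" for x
        by (auto intro!: derivative_eq_intros simp: has_vector_derivative_def scaleR_conv_of_real)
      show fv: "(f \<circ> (\<lambda>x. complex_of_real x * z) has_vector_derivative z * deriv f (complex_of_real x * z)) (at x)"
        if "0 < x" "x < 1" for x
        by (rule field_vector_diff_chain_at[OF vd fd]) (use xz that in auto)
      show "continuous_on {0..1} (f \<circ> (\<lambda>x. complex_of_real x * z))"
        using xz by (intro continuous_on_compose continuous_on_subset[OF holomorphic_on_imp_continuous_on[OF hol]])
          (auto intro!: continuous_intros)
      show "continuous_on {0..1} \<phi>" unfolding \<phi>_def
        using xz' by (intro continuous_intros) force
      show "(\<phi> has_vector_derivative cmod z * (M * (1 - x * cmod z) powr - (b + 1))) (at x)" if "0 < x" "x < 1" for x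
        unfolding \<phi>_def has_real_derivative_iff_has_vector_derivative[symmetric]
        using xz'[of x] that b by (auto intro!: derivative_eq_intros simp: field_simps minus_diff_commute)
      show "norm (z * deriv f (complex_of_real x * z)) \<le> cmod z * (M * (1 - x * cmod z) powr - (b + 1))" if "0 < x" "x < 1" for x
        using der[OF xz[of x]] that by (simp add: norm_mult mult_left_mono)
    qed simp
    also have "\<dots> \<le> M / b * (1 - cmod z) powr - b" using M b by (simp add: \<phi>_def)
    finally have "cmod (f z - f 0) \<le> M / b * (1 - cmod z) powr - b" by simp
    moreover have "1 \<le> (1 - cmod z) powr - b"
      using powr_mono2'[of "-b" "1 - cmod z" 1] z b by simp
    then have "cmod (f 0) \<le> cmod (f 0) * (1 - cmod z) powr - b" by (simp add: mult_le_cancel_left1)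
    ultimately show ?thesis using norm_triangle_sub[of "f z" "f 0"] by (simp add: distrib_right)
  qed
  show ?thesis
  proof
    show "0 \<le> cmod (f 0) + M / b + M" using M b by simp
    show "cmod (f z) \<le> (cmod (f 0) + M / b + M) * (1 - cmod z) powr - b" if "z \<in> ball 0 1" for z
      using size[OF that] M by (simp add: distrib_right add_increasing2)
    show "cmod (deriv f z) \<le> (cmod (f 0) + M / b + M) * (1 - cmod z) powr - (b + 1)" if "z \<in> ball 0 1" for z
      using der[OF that] M b by (simp add: distrib_right add_increasing del: minus_add_distrib)
  qed
qed

text \<open>Cauchy product of the Taylor series with the geometric series of
  \<open>1 / (1 - w)\<close>. Absolute convergence at \<open>w\<close> comes from convergence at a
  point of larger modulus still in the disc.\<close>

lemma taylor_partial_sums: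
  assumes f: "f holomorphic_on ball 0 1" and w: "w \<in> ball 0 1"
  shows "(\<lambda>n. (\<Sum>k\<le>n. taylor_coeff f k) * w ^ n) sums (f w / (1 - w))"
    and "summable (\<lambda>n. norm ((\<Sum>k\<le>n. taylor_coeff f k) * w ^ n))"
proof -
  have pow: "(\<lambda>k. taylor_coeff f k * v ^ k) sums f v" if "v \<in> ball 0 1" for v
    using holomorphic_power_series[OF f that] by (simp add: taylor_coeff_def)
  have bigger: "\<exists>v\<in>ball (0::complex) 1. norm u < norm v" if "u \<in> ball (0::complex) 1" for u
  proof
    show "norm u < norm (complex_of_real ((1 + norm u) / 2))" "complex_of_real ((1 + norm u) / 2) \<in> ball 0 1"
      using that by (simp_all only: norm_of_real mem_ball dist_0_norm) simp_all
  qed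
  have abs: "summable (\<lambda>k. norm (taylor_coeff f k * u ^ k))" if "u \<in> ball 0 1" for u
    using bigger[OF that] pow powser_insidea[of "taylor_coeff f"] by (blast dest: sums_summable)
  have S: "(\<lambda>n. (\<Sum>k\<le>n. taylor_coeff f k) * u ^ n) sums (f u / (1 - u))" if u: "u \<in> ball 0 1" for u
  proof -
    have "summable (\<lambda>k. norm (u ^ k))" using u by (simp add: norm_power summable_geometric)
    from Cauchy_product_sums[OF abs[OF u] this]
    have "(\<lambda>k. \<Sum>i\<le>k. taylor_coeff f i * u ^ i * u ^ (k - i)) sums (f u * (1 / (1 - u)))"
      using pow[OF u] u suminf_geometric[of u] by (simp add: sums_iff)
    then show ?thesis by (simp add: sum_distrib_right mult.assoc flip: power_add)
  qed
  show "(\<lambda>n. (\<Sum>k\<le>n. taylor_coeff f k) * w ^ n) sums (f w / (1 - w))" using S[OF w] .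
  show "summable (\<lambda>n. norm ((\<Sum>k\<le>n. taylor_coeff f k) * w ^ n))"
    using bigger[OF w] S powser_insidea[of "\<lambda>n. \<Sum>k\<le>n. taylor_coeff f k"] by (blast dest: sums_summable)
qed

text \<open>The measure lives on the whole line and gives no mass outside [0,1), so integrals are
  restricted to \<open>{0..<1}\<close> explicitly.\<close>

locale unit_interval_measure = finite_measure mu for mu :: "real measure" +
  assumes sets_mu: "sets mu = sets borel" and null: "emeasure mu (- {0..<1}) = 0"
begin

lemma measurable_mu [measurable_cong]: "sets mu = sets borel"
  by (fact sets_mu)

lemma AE_unit: "AE t in mu. t \<in> {0..<1}"
  using null by (intro AE_I[of _ _ "- {0..<1}"]) (auto simp: sets_mu)

section \<open>Integrals along a radius\<close>

lemma radial_in_ball: "t \<in> {0..<1} \<Longrightarrow> z \<in> cball 0 1 \<Longrightarrow> complex_of_real t * z \<in> ball 0 1"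
  using mult_left_le[of "cmod z" t] by (auto simp: norm_mult)

lemma radial_measurable:
  fixes \<phi> :: "complex \<Rightarrow> complex"
  assumes "continuous_on (ball 0 1) \<phi>" "z \<in> cball 0 1" "S \<in> sets borel" "S \<subseteq> {0..<1}"
  shows "(\<lambda>t. indicator S t *\<^sub>R \<phi> (complex_of_real t * z)) \<in> borel_measurable mu"
proof -
  have "continuous_on S (\<lambda>t. \<phi> (complex_of_real t * z))"
    using radial_in_ball[OF _ assms(2)] assms(4)
    by (intro continuous_on_compose2[OF assms(1)] continuous_intros) auto
  from borel_measurable_continuous_on_indicator[OF assms(3) this] show ?thesis
    using measurable_cong_sets[OF sets_mu refl] by blast
qed

text \<open>\<open>z\<close> may lie on the unit circle, where continuity of \<open>\<phi>\<close>
  in the open disc gives no bound up to \<open>t = 1\<close>; existence of the integral then rests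
  on the majorant \<open>w\<close>. That case yields the boundary values of the operator.\<close>

lemma radial_integral_bound:
  fixes \<phi> :: "complex \<Rightarrow> complex" and w :: "real \<Rightarrow> real"
  assumes "continuous_on (ball 0 1) \<phi>" "z \<in> cball 0 1" "S \<in> sets borel" "S \<subseteq> {0..<1}"
    and w: "set_integrable mu S w" "\<And>t. t \<in> S \<Longrightarrow> cmod (\<phi> (complex_of_real t * z)) \<le> w t"
  shows "set_integrable mu S (\<lambda>t. \<phi> (complex_of_real t * z))"
    and "cmod (LINT t:S|mu. \<phi> (complex_of_real t * z)) \<le> (LINT t:S|mu. w t)"
proof -
  have le: "norm (indicator S t *\<^sub>R \<phi> (complex_of_real t * z)) \<le> indicator S t *\<^sub>R w t" for t
    using w(2)[of t] by (simp add: indicator_def)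
  show int: "set_integrable mu S (\<lambda>t. \<phi> (complex_of_real t * z))"
    unfolding set_integrable_def
    by (rule Bochner_Integration.integrable_bound[OF w(1)[unfolded set_integrable_def] radial_measurable[OF assms(1-4)]])
      (intro AE_I2 order_trans[OF le], simp)
  have "cmod (LINT t:S|mu. \<phi> (complex_of_real t * z)) \<le> (LINT t:S|mu. cmod (\<phi> (complex_of_real t * z)))"
    by (rule set_integral_norm_bound[OF int])
  also have "\<dots> \<le> (LINT t:S|mu. w t)"
    using w int by (intro set_integral_mono set_integrable_norm) auto
  finally show "cmod (LINT t:S|mu. \<phi> (complex_of_real t * z)) \<le> (LINT t:S|mu. w t)" .
qed

lemma set_integrable_const: "S \<in> sets borel \<Longrightarrow> set_integrable mu S (\<lambda>t. c :: real)"
  unfolding set_integrable_def by (intro integrable_const_bound[of _ "\<bar>c\<bar>"]) (auto simp: indicator_def)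

text \<open>Sum and integral are exchanged: for \<open>t\<close> in [0,1) the terms at
  \<open>t * z\<close> are dominated by those at \<open>z\<close>, which are absolutely summable.
  Convergence of the series at every point of the disc also gives holomorphy.\<close>

lemma cesaro_op_sums:
  assumes f: "f holomorphic_on ball 0 1" and z: "z \<in> ball 0 1"
  shows "(\<lambda>n. complex_of_real (moment mu n) * (\<Sum>k\<le>n. taylor_coeff f k) * z ^ n) sums
     (LINT t:{0..<1}|mu. f (complex_of_real t * z) / (1 - complex_of_real t * z))"
proof -
  define A where "A = (\<lambda>n. \<Sum>k\<le>n. taylor_coeff f k)"
  \<comment> \<open>The indicator makes the domination hold for every real \<open>t\<close>, not
    just almost everywhere.\<close>
  define F where "F = (\<lambda>n t. indicator {0..<1} t *\<^sub>R (A n * (complex_of_real t * z) ^ n))"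
  have zc: "z \<in> cball 0 1" using z by simp
  have norm_F: "norm (F n t) \<le> norm (A n * z ^ n)" for n t
    using power_le_one[of t n] mult_left_le[of "\<bar>t\<bar> ^ n" "norm (A n * z ^ n)"]
    by (auto simp: F_def indicator_def norm_mult norm_power power_mult_distrib algebra_simps)
  have meas: "F n \<in> borel_measurable mu" for n
    unfolding F_def by (rule radial_measurable) (auto intro!: continuous_intros simp: z less_imp_le zc[simplified])
  have int: "integrable mu (F n)" for n
    using norm_F by (intro integrable_const_bound[OF _ meas]) auto
  have sm: "summable (\<lambda>n. norm (A n * z ^ n))"
    using taylor_partial_sums(2)[OF f z] by (simp add: A_def)
  have "(\<lambda>n. integral\<^sup>L mu (F n)) sums (\<integral>t. (\<Sum>n. F n t) \<partial>mu)"
  proof (rule sums_integral[OF int])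
    show "AE t in mu. summable (\<lambda>n. norm (F n t))"
      using norm_F by (intro AE_I2 summable_comparison_test'[OF sm]) auto
    show "summable (\<lambda>n. \<integral>t. norm (F n t) \<partial>mu)"
    proof (rule summable_comparison_test')
      show "summable (\<lambda>n. norm (A n * z ^ n) * measure mu (space mu))" using sm by (rule summable_mult2)
      show "norm (\<integral>t. norm (F n t) \<partial>mu) \<le> norm (A n * z ^ n) * measure mu (space mu)" if "n \<ge> 0" for n
        using integral_mono[of mu "\<lambda>t. norm (F n t)" "\<lambda>t. norm (A n * z ^ n)"] int norm_F
        by (simp add: mult.commute)
    qed
  qed
  moreover have "integral\<^sup>L mu (F n) = complex_of_real (moment mu n) * A n * z ^ n" for n
  proof -
    have "integral\<^sup>L mu (F n) = (\<integral>t. complex_of_real (t ^ n) * (A n * z ^ n) \<partial>mu)"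
    proof (rule integral_cong_AE)
      show "AE t in mu. F n t = complex_of_real (t ^ n) * (A n * z ^ n)"
        using AE_unit by eventually_elim (simp add: F_def power_mult_distrib)
    qed (use meas in measurable)
    also have "\<dots> = (\<integral>t. complex_of_real (t ^ n) \<partial>mu) * (A n * z ^ n)" by (rule integral_mult_left_zero)
    also have "(\<integral>t. complex_of_real (t ^ n) \<partial>mu) = complex_of_real (moment mu n)"
      unfolding moment_def by (rule integral_complex_of_real)
    finally show ?thesis by (simp add: mult.assoc)
  qed
  moreover have "(\<Sum>n. F n t) = indicator {0..<1} t *\<^sub>R (f (complex_of_real t * z) / (1 - complex_of_real t * z))" for t
    using taylor_partial_sums(1)[OF f radial_in_ball[OF _ zc], of t]
    by (auto simp: F_def A_def indicator_def sums_iff)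
  ultimately show ?thesis by (simp add: A_def set_lebesgue_integral_def)
qed

lemma cesaro_op_eq_integral:
  assumes "f holomorphic_on ball 0 1" "z \<in> ball 0 1"
  shows "cesaro_op mu f z = (LINT t:{0..<1}|mu. f (complex_of_real t * z) / (1 - complex_of_real t * z))"
  using cesaro_op_sums[OF assms] by (simp add: cesaro_op_def sums_iff)

lemma holomorphic_cesaro_op:
  assumes "f holomorphic_on ball 0 1"
  shows "cesaro_op mu f holomorphic_on ball 0 1"
  using cesaro_op_sums[OF assms] cesaro_op_eq_integral[OF assms]
  by (intro power_series_holomorphic[of 0 1 "\<lambda>n. complex_of_real (moment mu n) * (\<Sum>k\<le>n. taylor_coeff f k)"]) simp

text \<open>The integral formula sees only values in the disc. This lets representatives supplied by
  the inclusions between spaces be exchanged inside the operator.\<close>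

lemma cesaro_op_cong:
  assumes "f holomorphic_on ball 0 1" "\<And>w. w \<in> ball 0 1 \<Longrightarrow> g w = f w" "z \<in> ball 0 1"
  shows "cesaro_op mu g z = cesaro_op mu f z"
proof -
  have "g holomorphic_on ball 0 1" using assms(1,2) holomorphic_cong by blast
  moreover have "g (complex_of_real t * z) = f (complex_of_real t * z)" if "t \<in> {0..<1}" for t
    using assms(2) radial_in_ball[OF that, of z] assms(3) by simp
  ultimately show ?thesis
    using assms by (simp only: cesaro_op_eq_integral) (auto simp: set_lebesgue_integral_def indicator_def intro!: Bochner_Integration.integral_cong)
qed

lemma continuous_cesaro_kernel:
  "f holomorphic_on ball 0 1 \<Longrightarrow> continuous_on (ball 0 1) (\<lambda>w. f w / (1 - w))"
  by (intro continuous_intros holomorphic_on_imp_continuous_on) auto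

text \<open>The point \<open>t * z\<close> stays in the disc of radius \<open>cmod z\<close>, where
  \<open>f\<close> is at most \<open>B\<close> and the kernel at most
  \<open>1 / (1 - cmod z)\<close>. The second conclusion is the pointwise continuity that the closed
  graph theorem asks for.\<close>

lemma cesaro_op_pointwise_bound:
  assumes f: "f holomorphic_on ball 0 1" and z: "z \<in> ball 0 1"
    and B: "\<And>w. w \<in> cball 0 (cmod z) \<Longrightarrow> cmod (f w) \<le> B"
  shows "set_integrable mu {0..<1} (\<lambda>t. f (complex_of_real t * z) / (1 - complex_of_real t * z))"
    and "cmod (cesaro_op mu f z) \<le> measure mu {0..<1} / (1 - cmod z) * B"
proof -
  have le: "cmod (f (complex_of_real t * z) / (1 - complex_of_real t * z)) \<le> B / (1 - cmod z)"
    if t: "t \<in> {0..<1}" for t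
  proof -
    have tz: "cmod (complex_of_real t * z) \<le> cmod z"
      using t by (simp add: norm_mult mult_left_le_one_le)
    have "1 - cmod z \<le> cmod (1 - complex_of_real t * z)"
      using norm_triangle_ineq2[of 1 "complex_of_real t * z"] tz by simp
    then show ?thesis using B[of "complex_of_real t * z"] tz z
      by (simp add: norm_divide frac_le order_trans[OF norm_ge_zero])
  qed
  have zc: "z \<in> cball 0 1" using z by simp
  note rb = radial_integral_bound[OF continuous_cesaro_kernel[OF f] zc _ _ set_integrable_const le]
  show "set_integrable mu {0..<1} (\<lambda>t. f (complex_of_real t * z) / (1 - complex_of_real t * z))"
    by (rule rb(1)) auto
  have "cmod (cesaro_op mu f z) \<le> (LINT t:{0..<1}|mu. B / (1 - cmod z))"
    unfolding cesaro_op_eq_integral[OF f z] by (rule rb(2)) auto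
  also have "\<dots> = measure mu {0..<1} / (1 - cmod z) * B"
    by (simp add: set_lebesgue_integral_def)
  finally show "cmod (cesaro_op mu f z) \<le> measure mu {0..<1} / (1 - cmod z) * B" .
qed

lemma cesaro_kernel_set_integrable:
  assumes f: "f holomorphic_on ball 0 1" and z: "z \<in> ball 0 1"
  shows "set_integrable mu {0..<1} (\<lambda>t. f (complex_of_real t * z) / (1 - complex_of_real t * z))"
proof -
  have "cball 0 (cmod z) \<subseteq> ball (0::complex) 1" using z by auto
  then have "compact (f ` cball 0 (cmod z))"
    by (intro compact_continuous_image holomorphic_on_imp_continuous_on holomorphic_on_subset[OF f]) auto
  then obtain B where "\<And>w. w \<in> cball 0 (cmod z) \<Longrightarrow> cmod (f w) \<le> B"
    using compact_imp_bounded bounded_iff by (metis imageI)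
  then show ?thesis by (rule cesaro_op_pointwise_bound(1)[OF f z])
qed

lemma cesaro_op_diff:
  assumes "f holomorphic_on ball 0 1" "g holomorphic_on ball 0 1" "z \<in> ball 0 1"
  shows "cesaro_op mu (\<lambda>w. f w - g w) z = cesaro_op mu f z - cesaro_op mu g z"
  using cesaro_kernel_set_integrable[OF assms(1,3)] cesaro_kernel_set_integrable[OF assms(2,3)] assms
  by (simp add: cesaro_op_eq_integral holomorphic_on_diff diff_divide_distrib set_integral_diff)

lemma cesaro_op_scale:
  assumes "f holomorphic_on ball 0 1" "z \<in> ball 0 1"
  shows "cesaro_op mu (\<lambda>w. c * f w) z = c * cesaro_op mu f z"
  using assms set_integral_mult_right[where a = c and M = mu and A = "{0..<1}"]
  by (simp add: cesaro_op_eq_integral holomorphic_on_mult flip: times_divide_eq_right)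

text \<open>The Bloch bound makes the increment of \<open>h\<close> between \<open>1 - 4 * d\<close>
  and \<open>1 - d\<close> at most of order \<open>d powr (1 - a)\<close>; dividing by
  \<open>d powr - (b + 1)\<close> leaves the exponent \<open>b + 2 - a\<close>. In the application
  \<open>a\<close> is the Bloch exponent attached to \<open>Y\<close>, and \<open>h\<close>
  represents the image of the test function.\<close>

lemma carleson_if_cesaro_op_bloch:
  fixes b a :: real
  assumes b: "0 < b" and a: "0 < a" "a \<le> b + 2"
    and h: "h \<in> bloch_type a"
      "\<And>z. z \<in> ball 0 1 \<Longrightarrow> h z = cesaro_op mu (\<lambda>w. (1 - w) powr complex_of_real (- b)) z"
    and F: "(\<lambda>w. (1 - w) powr complex_of_real (- b)) holomorphic_on ball 0 1"
  shows "carleson mu (b + 2 - a)"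
proof -
  let ?p = "b + 1"
  define J where "J = (\<lambda>r. LINT t:{0..<1}|mu. (1 - t * r) powr - ?p)"
  have J_int: "set_integrable mu {0..<1} (\<lambda>t. (1 - t * r) powr - ?p)"
    and h_J: "h (complex_of_real r) = complex_of_real (J r)" if r: "0 \<le> r" "r < 1" for r
  proof -
    have rb: "complex_of_real r \<in> ball 0 1" using r by simp
    have eq: "(1 - complex_of_real t * complex_of_real r) powr complex_of_real (- b) / (1 - complex_of_real t * complex_of_real r)
        = complex_of_real ((1 - t * r) powr - ?p)" if t: "t \<in> {0..<1}" for t
    proof -
      have "t * r < 1" using t r mult_left_le[of r t] by (simp add: mult.commute)
      then have pos: "0 < 1 - t * r" by simp
      have "(1 - complex_of_real t * complex_of_real r) = complex_of_real (1 - t * r)" by simp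
      then have "(1 - complex_of_real t * complex_of_real r) powr complex_of_real (- b) / (1 - complex_of_real t * complex_of_real r)
         = complex_of_real (1 - t * r) powr complex_of_real (- b) / complex_of_real (1 - t * r)" by (simp only:)
      also have "\<dots> = complex_of_real ((1 - t * r) powr (- b) / (1 - t * r))"
        using pos by (simp only: powr_of_real[OF less_imp_le] of_real_divide)
      also have "(1 - t * r) powr (- b) / (1 - t * r) = (1 - t * r) powr - ?p"
        using pos by (simp add: powr_minus powr_add field_simps del: minus_add_distrib)
      finally show ?thesis .
    qed
    have cong: "indicator {0..<1} t *\<^sub>R ((1 - complex_of_real t * complex_of_real r) powr complex_of_real (- b) / (1 - complex_of_real t * complex_of_real r))
        = complex_of_real (indicator {0..<1} t *\<^sub>R (1 - t * r) powr - ?p)" for t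
      using eq[of t] by (simp add: indicator_def)
    have "integrable mu (\<lambda>t. complex_of_real (indicator {0..<1} t *\<^sub>R (1 - t * r) powr - ?p))"
      using cesaro_kernel_set_integrable[OF F rb] unfolding set_integrable_def cong .
    from integrable_Re[OF this] show "set_integrable mu {0..<1} (\<lambda>t. (1 - t * r) powr - ?p)"
      unfolding set_integrable_def Re_complex_of_real .
    have "h (complex_of_real r) = (\<integral>t. complex_of_real (indicator {0..<1} t *\<^sub>R (1 - t * r) powr - ?p) \<partial>mu)"
      unfolding h(2)[OF rb] cesaro_op_eq_integral[OF F rb] set_lebesgue_integral_def cong ..
    also have "\<dots> = complex_of_real (J r)"
      unfolding J_def set_lebesgue_integral_def by (rule integral_complex_of_real)
    finally show "h (complex_of_real r) = complex_of_real (J r)" .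
  qed
  have hol: "h holomorphic_on ball 0 1" using h(1) by (simp add: bloch_type_def)
  obtain M0 where M0: "\<And>z. z \<in> ball 0 1 \<Longrightarrow> (1 - (cmod z)\<^sup>2) powr a * cmod (deriv h z) \<le> M0"
    using h(1) unfolding bloch_type_def by blast
  have der: "(1 - x\<^sup>2) powr a * cmod (deriv h (complex_of_real x)) \<le> M0" if "0 \<le> x" "x < 1" for x
    using that M0[of "complex_of_real x"] by simp
  \<comment> \<open>For \<open>1 - d \<le> t < 1\<close> the base \<open>1 - t * (1 - d)\<close> is
    at most \<open>2 * d\<close> and \<open>1 - t * (1 - 4 * d)\<close> is at least
    \<open>4 * d\<close>, so the powers differ by at least \<open>c * d powr - ?p\<close>. The
    factor 4 exceeds 2, hence \<open>c > 0\<close>.\<close>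
  define c where "c = 2 powr - ?p - 4 powr - ?p"
  have c: "c > 0" using b unfolding c_def by (simp add: powr_less_mono2_neg)
  have small: "measure mu {1 - d..<1} \<le> (3 * M0 / c) * d powr (b + 2 - a)" if d: "0 < d" "d \<le> 1 / 4" for d
  proof -
    \<comment> \<open>Mean value estimate on this segment of length \<open>3 * d\<close>: there
      \<open>1 - x\<^sup>2 \<ge> d\<close>, so the derivative is at most
      \<open>M0 * d powr - a\<close>. The condition \<open>d \<le> 1 / 4\<close> keeps the left end
      nonnegative.\<close>
    let ?S = "closed_segment (complex_of_real (1 - 4 * d)) (complex_of_real (1 - d))"
    have S: "\<exists>x. w = complex_of_real x \<and> 1 - 4 * d \<le> x \<and> x \<le> 1 - d" if "w \<in> ?S" for w
      using that d unfolding closed_segment_of_real by (auto simp: closed_segment_eq_real_ivl)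
    have "cmod (h (complex_of_real (1 - d)) - h (complex_of_real (1 - 4 * d)))
        \<le> (M0 * d powr - a) * cmod (complex_of_real (1 - d) - complex_of_real (1 - 4 * d))"
    proof (rule field_differentiable_bound[OF convex_closed_segment])
      fix w assume "w \<in> ?S"
      then obtain x where x: "w = complex_of_real x" "1 - 4 * d \<le> x" "x \<le> 1 - d" using S by blast
      have x01: "0 \<le> x" "x < 1" using x d by auto
      show "(h has_field_derivative deriv h w) (at w within ?S)"
        using holomorphic_derivI[OF hol] x x01 by (simp add: has_field_derivative_at_within)
      have "d \<le> 1 - x\<^sup>2" using x01 x(3) power_decreasing[of 1 2 x] by simp
      then have "d powr a * cmod (deriv h w) \<le> (1 - x\<^sup>2) powr a * cmod (deriv h w)"
        using d a by (intro mult_right_mono powr_mono2) auto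
      also have "\<dots> \<le> M0" using der[OF x01] x by simp
      finally show "cmod (deriv h w) \<le> M0 * d powr - a" using d by (simp add: powr_minus field_simps)
    qed auto
    also have "cmod (complex_of_real (1 - d) - complex_of_real (1 - 4 * d)) = 3 * d"
      unfolding of_real_diff[symmetric] norm_of_real using d by simp
    also have "h (complex_of_real (1 - d)) - h (complex_of_real (1 - 4 * d)) = complex_of_real (J (1 - d) - J (1 - 4 * d))"
      using h_J[of "1 - d"] h_J[of "1 - 4 * d"] d by simp
    finally have up: "J (1 - d) - J (1 - 4 * d) \<le> M0 * d powr - a * (3 * d)"
      unfolding norm_of_real by linarith
    have "(LINT t:{0..<1}|mu. indicator {1 - d..<1} t * (c * d powr - ?p))
        \<le> (LINT t:{0..<1}|mu. (1 - t * (1 - d)) powr - ?p - (1 - t * (1 - 4 * d)) powr - ?p)"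
    proof (rule set_integral_mono)
      show "set_integrable mu {0..<1} (\<lambda>t. indicator {1 - d..<1} t * (c * d powr - ?p))"
        unfolding set_integrable_def by (intro integrable_const_bound[of _ "\<bar>c * d powr - ?p\<bar>"]) (auto simp: indicator_def)
      show "set_integrable mu {0..<1} (\<lambda>t. (1 - t * (1 - d)) powr - ?p - (1 - t * (1 - 4 * d)) powr - ?p)"
        using J_int[of "1 - d"] J_int[of "1 - 4 * d"] d by (intro set_integral_diff) auto
      fix t :: real assume t: "t \<in> {0..<1}"
      show "indicator {1 - d..<1} t * (c * d powr - ?p) \<le> (1 - t * (1 - d)) powr - ?p - (1 - t * (1 - 4 * d)) powr - ?p"
      proof (cases "1 - d \<le> t")
        case True
        have td: "t * d \<le> d" using t d by (simp add: mult_left_le_one_le)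
        have pos: "0 < 1 - t * (1 - d)" using t d by (smt (verit) atLeastLessThan_iff mult_left_le)
        have le1: "1 - t * (1 - d) \<le> 2 * d" using True td by (simp add: algebra_simps)
        have ge4: "4 * d \<le> 1 - t * (1 - 4 * d)"
          using mult_right_le_one_le[of "1 - 4 * d" t] t d by (simp add: mult.commute)
        have "(2 * d) powr - ?p \<le> (1 - t * (1 - d)) powr - ?p"
          using pos le1 b by (intro powr_mono2') auto
        moreover have "(1 - t * (1 - 4 * d)) powr - ?p \<le> (4 * d) powr - ?p"
          using ge4 d b by (intro powr_mono2') auto
        moreover have "c * d powr - ?p = (2 * d) powr - ?p - (4 * d) powr - ?p"
          by (simp add: c_def powr_mult left_diff_distrib)
        ultimately show ?thesis using True t by simp
      next
        \<comment> \<open>Away from 1 only monotonicity of \<open>(1 - t * r) powr - ?p\<close> in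
          \<open>r\<close> is used: the difference is nonnegative.\<close>
        case False
        have "t * (1 - 4 * d) \<le> t * (1 - d)" using t d by (intro mult_left_mono) auto
        moreover have "0 < 1 - t * (1 - d)" using t d by (smt (verit) atLeastLessThan_iff mult_left_le)
        ultimately have "(1 - t * (1 - 4 * d)) powr - ?p \<le> (1 - t * (1 - d)) powr - ?p"
          using b by (intro powr_mono2') auto
        then show ?thesis using False by simp
      qed
    qed
    also have "\<dots> = J (1 - d) - J (1 - 4 * d)"
      unfolding J_def using J_int[of "1 - d"] J_int[of "1 - 4 * d"] d by (intro set_integral_diff) auto
    also have "(LINT t:{0..<1}|mu. indicator {1 - d..<1} t * (c * d powr - ?p)) = measure mu {1 - d..<1} * (c * d powr - ?p)"
    proof -
      have "(LINT t:{0..<1}|mu. indicator {1 - d..<1} t * (c * d powr - ?p)) = (\<integral>t. indicator {1 - d..<1} t * (c * d powr - ?p) \<partial>mu)"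
        unfolding set_lebesgue_integral_def using d by (intro Bochner_Integration.integral_cong) (auto simp: indicator_def)
      then show ?thesis by simp
    qed
    finally have "measure mu {1 - d..<1} * (c * d powr - ?p) \<le> M0 * d powr - a * (3 * d)" using up by simp
    then have "measure mu {1 - d..<1} \<le> M0 * d powr - a * (3 * d) / (c * d powr - ?p)"
      using c d by (simp add: pos_le_divide_eq)
    also have "\<dots> = (3 * M0 / c) * (d powr - a * d / d powr - ?p)" by simp
    also have "d powr - a * d / d powr - ?p = d powr (- a + 1 - - ?p)"
      using d by (simp only: powr_diff powr_add powr_one less_imp_le)
    also have "- a + 1 - - ?p = b + 2 - a" by simp
    finally show ?thesis .
  qed
  show ?thesis
    unfolding carleson_def
  proof (intro exI allI impI)
    \<comment> \<open>For \<open>1 - t > 1 / 4\<close> the total mass is bound enough: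
      \<open>4 * (1 - t)\<close> exceeds 1 and the exponent is nonnegative.\<close>
    let ?s = "b + 2 - a" and ?K = "measure mu (space mu) * 4 powr (b + 2 - a)"
    fix t :: real assume t: "0 \<le> t \<and> t < 1"
    show "measure mu {t..<1} \<le> max (3 * M0 / c) ?K * (1 - t) powr ?s"
    proof (cases "1 - t \<le> 1 / 4")
      case True
      then have "measure mu {t..<1} \<le> (3 * M0 / c) * (1 - t) powr ?s" using small[of "1 - t"] t by simp
      also have "\<dots> \<le> max (3 * M0 / c) ?K * (1 - t) powr ?s" by (intro mult_right_mono) auto
      finally show ?thesis .
    next
      case False
      have "1 \<le> (4 * (1 - t)) powr ?s" using False a by (intro ge_one_powr_ge_zero) auto
      then have "measure mu (space mu) * 1 \<le> measure mu (space mu) * (4 * (1 - t)) powr ?s"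
        by (intro mult_left_mono) auto
      also have "\<dots> = ?K * (1 - t) powr ?s" by (simp only: powr_mult mult.assoc)
      also have "\<dots> \<le> max (3 * M0 / c) ?K * (1 - t) powr ?s" by (intro mult_right_mono) auto
      finally show ?thesis using bounded_measure[of "{t..<1}"] by simp
    qed
  qed
qed

text \<open>The target is an oscillation of size \<open>l powr - e\<close> on arcs of length
  \<open>l\<close>, with \<open>e = (1 - lam) / 2\<close>: its square integrated over the arc has
  order \<open>l powr (1 - 2 * e) = l powr lam\<close>.\<close>

lemma cesaro_op_in_morrey:
  fixes b lam :: real
  assumes b: "0 < b" and lam: "0 < lam" "lam \<le> 1"
    and car: "carleson mu (b + (1 + lam) / 2)" and f: "f \<in> bloch_type (b + 1)"
  shows "cesaro_op mu f \<in> morrey lam"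
proof -
  \<comment> \<open>\<open>g\<close> is the midpoint of \<open>e\<close> and \<open>1 / 2\<close>.
    Below \<open>1 / 2\<close> it keeps \<open>cmod (1 - cis x) powr - g\<close> square integrable;
    above \<open>e\<close> it makes \<open>s - p = g - e\<close> positive, so the Carleson condition
    controls \<open>(1 - t) powr - p\<close> up to \<open>t = 1\<close>.\<close>
  define s g where "s = b + (1 + lam) / 2" and "g = 1 / 2 - lam / 4"
  define p where "p = b + 1 - g"
  define e where "e = (1 - lam) / 2"
  have g: "0 \<le> g" "g < 1 / 2" "g \<le> 1" and p: "0 \<le> p" "p < s" and s: "0 \<le> s" "s < b + 2"
    using b lam by (auto simp: s_def g_def p_def)
  have exps: "1 + (s - (b + 2)) = - e" "s - p = g - e" "1 - 2 * e = lam"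
    by (auto simp: s_def p_def e_def field_simps)
  have hol: "f holomorphic_on ball 0 1" using f by (simp add: bloch_type_def)
  obtain M where M: "M \<ge> 0"
    "\<And>z. z \<in> ball 0 1 \<Longrightarrow> cmod (f z) \<le> M * (1 - cmod z) powr - b"
    "\<And>z. z \<in> ball 0 1 \<Longrightarrow> cmod (deriv f z) \<le> M * (1 - cmod z) powr - (b + 1)"
    using bloch_type_growth[OF f b] by blast
  define \<phi> where "\<phi> = (\<lambda>w. f w / (1 - w))"
  have cont: "continuous_on (ball 0 1) \<phi>" unfolding \<phi>_def by (rule continuous_cesaro_kernel[OF hol])
  obtain C1 where C1: "C1 \<ge> 0"
    "\<And>l. l > 0 \<Longrightarrow> set_integrable mu ({0..<1} \<inter> {1 - l..}) (\<lambda>t. (1 - t) powr - p)"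
    "\<And>l. l > 0 \<Longrightarrow> (LINT t:{0..<1} \<inter> {1 - l..}|mu. (1 - t) powr - p) \<le> C1 * l powr (s - p)"
    using carleson_near_integral_le[OF finite_measure_axioms sets_mu car[folded s_def] p] by blast
  obtain C2 where C2: "C2 \<ge> 0"
    "\<And>l. l > 0 \<Longrightarrow> set_integrable mu ({0..<1} \<inter> {..<1 - l}) (\<lambda>t. (1 - t) powr - (b + 2))"
    "\<And>l. l > 0 \<Longrightarrow> (LINT t:{0..<1} \<inter> {..<1 - l}|mu. (1 - t) powr - (b + 2)) \<le> C2 * l powr (s - (b + 2))"
    using carleson_far_integral_le[OF finite_measure_axioms sets_mu car[folded s_def] s] by blast
  obtain C3 where C3: "C3 \<ge> 0" "\<And>a l. 0 < l \<Longrightarrow> l \<le> 2 * pi \<Longrightarrow>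
    (\<integral>\<^sup>+x\<in>{a..a+l}. ennreal (cmod (1 - cis x) powr - (2 * g)) \<partial>lborel) \<le> ennreal (C3 * l powr (1 - 2 * g))"
    using nn_integral_cis_powr_le[of "2 * g"] g by auto

  have one_minus: "1 - cmod w \<le> cmod (1 - w)" for w :: complex
    using norm_triangle_ineq2[of 1 w] by simp
  define D where "D = M * 2 powr g"
  have D: "D \<ge> 0" using M by (simp add: D_def)
  \<comment> \<open>The factor \<open>1 / cmod (1 - ?w)\<close> is split into exponents
    \<open>1 - g\<close> and \<open>g\<close>, the first absorbed by \<open>1 - t\<close>, the
    second by the angle. Allowing \<open>r = 1\<close> makes the bound serve for radial limits and
    on the circle alike.\<close>
  have size: "cmod (\<phi> (complex_of_real t * (complex_of_real r * cis x))) \<le> D * cmod (1 - cis x) powr - g * (1 - t) powr - p"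
    if t: "t \<in> {0..<1}" and r: "0 \<le> r" "r \<le> 1" and x: "cis x \<noteq> 1" for t r x
  proof -
    let ?w = "complex_of_real t * (complex_of_real r * cis x)"
    have tr: "cmod ?w \<le> t" "0 \<le> t * r" "t * r \<le> 1"
      using t r mult_left_le[of r t] by (auto simp: norm_mult)
    have w: "?w \<in> ball 0 1" using tr t by auto
    have w1: "1 - t \<le> cmod (1 - ?w)" using one_minus[of ?w] tr by simp
    have w2: "cmod (1 - cis x) / 2 \<le> cmod (1 - ?w)"
      using cmod_one_minus_cis_radial_le[of "t * r" x] tr by (simp add: mult.assoc)
    have pos: "0 < cmod (1 - cis x) / 2" using x by simp
    have "cmod (\<phi> ?w) = cmod (f ?w) * cmod (1 - ?w) powr (- (1 - g) + - g)"
      using w1 t by (simp add: \<phi>_def norm_divide powr_minus field_simps)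
    also have "\<dots> = cmod (f ?w) * (cmod (1 - ?w) powr - (1 - g) * cmod (1 - ?w) powr - g)"
      by (simp only: powr_add)
    also have "\<dots> \<le> (M * (1 - t) powr - b) * ((1 - t) powr - (1 - g) * (cmod (1 - cis x) / 2) powr - g)"
    proof (intro mult_mono)
      have "M * (1 - cmod ?w) powr - b \<le> M * (1 - t) powr - b"
        using M(1) tr t b by (intro mult_left_mono powr_mono2') auto
      then show "cmod (f ?w) \<le> M * (1 - t) powr - b" using M(2)[OF w] by simp
      show "cmod (1 - ?w) powr - (1 - g) \<le> (1 - t) powr - (1 - g)"
        using w1 t g by (intro powr_mono2') auto
      show "cmod (1 - ?w) powr - g \<le> (cmod (1 - cis x) / 2) powr - g"
        using w2 pos g by (intro powr_mono2') auto
    qed (use M in auto)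
    also have "\<dots> = M * (cmod (1 - cis x) / 2) powr - g * ((1 - t) powr - b * (1 - t) powr - (1 - g))"
      by simp
    also have "(1 - t) powr - b * (1 - t) powr - (1 - g) = (1 - t) powr - p"
      unfolding powr_add[symmetric] by (simp add: p_def algebra_simps)
    also have "M * (cmod (1 - cis x) / 2) powr - g = D * cmod (1 - cis x) powr - g"
      by (simp add: D_def powr_divide powr_minus field_simps)
    finally show ?thesis .
  qed
  \<comment> \<open>With \<open>l = 1\<close> the near part is all of [0,1).\<close>
  have whole: "{0..<1} \<inter> {1 - 1..} = {0..<(1::real)}" by auto
  have int_p: "set_integrable mu {0..<1} (\<lambda>t. (1 - t) powr - p)"
    and int_p_le: "(LINT t:{0..<1}|mu. (1 - t) powr - p) \<le> C1"
    using C1(2)[of 1] C1(3)[of 1] unfolding whole by auto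
  have cesaro: "cesaro_op mu f z = (LINT t:{0..<1}|mu. \<phi> (complex_of_real t * z))" if "z \<in> ball 0 1" for z
    using cesaro_op_eq_integral[OF hol that] by (simp add: \<phi>_def)
  define G where "G = (\<lambda>x. LINT t:{0..<1}|mu. \<phi> (complex_of_real t * cis x))"

  have lim: "((\<lambda>r. cesaro_op mu f (complex_of_real r * cis x)) \<longlongrightarrow> G x) (at_left 1)" if x: "cis x \<noteq> 1" for x
  proof (rule tendsto_at_left_sequentially[of 0])
    fix S :: "nat \<Rightarrow> real" assume S: "\<And>n. S n < 1" "\<And>n. 0 < S n" "S \<longlonglongrightarrow> 1"
    have Sc: "complex_of_real (S n) * cis x \<in> cball 0 1" for n
      using S(1,2)[of n] by (simp add: norm_mult)
    have "(\<lambda>n. LINT t:{0..<1}|mu. \<phi> (complex_of_real t * (complex_of_real (S n) * cis x))) \<longlonglongrightarrow> G x"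
      unfolding G_def set_lebesgue_integral_def
    proof (rule integral_dominated_convergence)
      show "integrable mu (\<lambda>t. indicator {0..<1} t *\<^sub>R (D * cmod (1 - cis x) powr - g * (1 - t) powr - p))"
        using set_integrable_mult_right[of "D * cmod (1 - cis x) powr - g" mu "{0..<1}"] int_p
        by (simp add: set_integrable_def)
      show "(\<lambda>t. indicator {0..<1} t *\<^sub>R \<phi> (complex_of_real t * cis x)) \<in> borel_measurable mu"
        by (rule radial_measurable[OF cont]) auto
      show "(\<lambda>t. indicator {0..<1} t *\<^sub>R \<phi> (complex_of_real t * (complex_of_real (S n) * cis x))) \<in> borel_measurable mu" for n
        using Sc by (intro radial_measurable[OF cont]) auto
      show "AE t in mu. norm (indicator {0..<1} t *\<^sub>R \<phi> (complex_of_real t * (complex_of_real (S n) * cis x)))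
          \<le> indicator {0..<1} t *\<^sub>R (D * cmod (1 - cis x) powr - g * (1 - t) powr - p)" for n
        using size[OF _ _ _ x, of _ "S n"] S(1,2)[of n] by (intro AE_I2) (auto simp: indicator_def less_imp_le)
      show "AE t in mu. (\<lambda>n. indicator {0..<1} t *\<^sub>R \<phi> (complex_of_real t * (complex_of_real (S n) * cis x)))
          \<longlonglongrightarrow> indicator {0..<1} t *\<^sub>R \<phi> (complex_of_real t * cis x)"
        using AE_unit
      proof eventually_elim
        case (elim t)
        have "isCont \<phi> (complex_of_real t * cis x)"
          using cont elim by (auto simp: continuous_on_eq_continuous_at norm_mult)
        moreover have "(\<lambda>n. complex_of_real t * (complex_of_real (S n) * cis x)) \<longlonglongrightarrow> complex_of_real t * (complex_of_real 1 * cis x)"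
          by (intro tendsto_intros S)
        ultimately have "(\<lambda>n. \<phi> (complex_of_real t * (complex_of_real (S n) * cis x))) \<longlonglongrightarrow> \<phi> (complex_of_real t * cis x)"
          using isCont_tendsto_compose by fastforce
        then show ?case by (intro tendsto_intros)
      qed
    qed
    then show "(\<lambda>n. cesaro_op mu f (complex_of_real (S n) * cis x)) \<longlonglongrightarrow> G x"
      using S(1,2) by (subst cesaro) (auto simp: norm_mult less_imp_le)
  qed simp

  have hardy: "cesaro_op mu f \<in> hardy2"
  proof (rule hardy2I[OF holomorphic_cesaro_op[OF hol] g(1,2)])
    fix r x :: real assume r: "0 \<le> r" "r < 1" and x: "cis x \<noteq> 1"
    let ?q = "D * cmod (1 - cis x) powr - g"
    have z: "complex_of_real r * cis x \<in> ball 0 1" using r by (simp add: norm_mult)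
    have "cmod (cesaro_op mu f (complex_of_real r * cis x)) \<le> (LINT t:{0..<1}|mu. ?q * (1 - t) powr - p)"
      unfolding cesaro[OF z] using z size[OF _ r(1) _ x] r int_p
      by (intro radial_integral_bound(2)[OF cont]) (auto simp: less_imp_le)
    also have "\<dots> = ?q * (LINT t:{0..<1}|mu. (1 - t) powr - p)" by simp
    also have "\<dots> \<le> ?q * C1" using int_p_le D by (intro mult_left_mono) auto
    finally show "cmod (cesaro_op mu f (complex_of_real r * cis x)) \<le> D * C1 * cmod (1 - cis x) powr - g"
      by (simp add: mult_ac)
  qed

  \<comment> \<open>The derivative of \<open>\<phi>\<close> is
    \<open>f' / (1 - w) + f / (1 - w)\<^sup>2\<close>, and each term is at most
    \<open>M * (1 - t) powr - (b + 2)\<close> on the convex disc of radius \<open>t\<close>, which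
    contains both points.\<close>
  have lipschitz: "cmod (\<phi> (complex_of_real t * cis x) - \<phi> (complex_of_real t * cis y)) \<le> 2 * M * (1 - t) powr - (b + 2) * \<bar>x - y\<bar>"
    if t: "t \<in> {0..<1}" for t x y
  proof -
    have "cmod (\<phi> (complex_of_real t * cis x) - \<phi> (complex_of_real t * cis y))
        \<le> (2 * M * (1 - t) powr - (b + 2)) * cmod (complex_of_real t * cis x - complex_of_real t * cis y)"
    proof (rule field_differentiable_bound[OF convex_cball[of 0 t]])
      fix w :: complex assume w: "w \<in> cball 0 t"
      then have wb: "w \<in> ball 0 1" and wt: "1 - t \<le> 1 - cmod w" and w1: "w \<noteq> 1" using t by auto
      have ow: "1 - t \<le> cmod (1 - w)" using one_minus[of w] wt by simp
      let ?d = "deriv f w / (1 - w) + f w / (1 - w)\<^sup>2"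
      have "(\<phi> has_field_derivative (deriv f w * (1 - w) - f w * (0 - 1)) / ((1 - w) * (1 - w))) (at w)"
        unfolding \<phi>_def using w1 by (intro DERIV_divide holomorphic_derivI[OF hol open_ball wb] derivative_intros) auto
      also have "(deriv f w * (1 - w) - f w * (0 - 1)) / ((1 - w) * (1 - w)) = ?d"
        using w1 by (simp add: add_divide_distrib power2_eq_square)
      finally have "(\<phi> has_field_derivative ?d) (at w)" .
      then show "(\<phi> has_field_derivative ?d) (at w within cball 0 t)" by (rule has_field_derivative_at_within)
      have pos: "0 < 1 - t" using t by simp
      have "cmod ?d \<le> cmod (deriv f w) / cmod (1 - w) + cmod (f w) / (cmod (1 - w))\<^sup>2"
        using norm_triangle_ineq[of "deriv f w / (1 - w)" "f w / (1 - w)\<^sup>2"] by (simp add: norm_divide norm_power)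
      also have "\<dots> \<le> M * (1 - t) powr - (b + 1) / (1 - t) + M * (1 - t) powr - b / (1 - t)\<^sup>2"
      proof (intro add_mono frac_le power_mono)
        have "M * (1 - cmod w) powr - (b + 1) \<le> M * (1 - t) powr - (b + 1)"
          using M(1) wt pos b by (intro mult_left_mono powr_mono2') auto
        then show "cmod (deriv f w) \<le> M * (1 - t) powr - (b + 1)" using M(3)[OF wb] by linarith
        have "M * (1 - cmod w) powr - b \<le> M * (1 - t) powr - b"
          using M(1) wt pos b by (intro mult_left_mono powr_mono2') auto
        then show "cmod (f w) \<le> M * (1 - t) powr - b" using M(2)[OF wb] by linarith
      qed (use M pos ow in auto)
      also have "\<dots> = 2 * M * (1 - t) powr - (b + 2)"
        using pos by (simp add: powr_minus powr_add power2_eq_square field_simps del: minus_add_distrib)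
      finally show "cmod ?d \<le> 2 * M * (1 - t) powr - (b + 2)" .
    qed (use t in \<open>auto simp: norm_mult\<close>)
    also have "complex_of_real t * cis x - complex_of_real t * cis y = complex_of_real t * (cis x - cis y)"
      by (simp add: algebra_simps)
    also have "cmod \<dots> \<le> \<bar>x - y\<bar>"
      using t cmod_cis_diff_le[of x y] mult_left_le_one_le[of "cmod (cis x - cis y)" t] by (simp add: norm_mult)
    finally show ?thesis using M by (simp add: mult_left_mono)
  qed

  \<comment> \<open>The integrand is even at most \<open>M * (1 - t) powr - (b + 1)\<close>; since
    \<open>1 - t \<le> 1\<close> the exponent may be raised to \<open>b + 2\<close>, which reuses
    the far estimate. This covers every angle, including \<open>cis x = 1\<close>.\<close>
  have far_int: "set_integrable mu ({0..<1} \<inter> {..<1 - l}) (\<lambda>t. \<phi> (complex_of_real t * cis x))" if l: "l > 0" for l x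
  proof (rule radial_integral_bound(1)[OF cont])
    show "set_integrable mu ({0..<1} \<inter> {..<1 - l}) (\<lambda>t. M * (1 - t) powr - (b + 2))"
      using C2(2)[OF l] by simp
    fix t assume "t \<in> {0..<1} \<inter> {..<1 - l}"
    then have t: "0 \<le> t" "t < 1" by auto
    let ?w = "complex_of_real t * cis x"
    have w: "cmod ?w = t" using t by (simp add: norm_mult)
    have "cmod (\<phi> ?w) \<le> M * (1 - t) powr - b / (1 - t)"
      unfolding \<phi>_def norm_divide using M(1) M(2)[of ?w] one_minus[of ?w] w t by (intro frac_le) auto
    also have "\<dots> = M * (1 - t) powr - (b + 1)"
      using t by (simp add: powr_minus powr_add field_simps del: minus_add_distrib)
    also have "\<dots> \<le> M * (1 - t) powr - (b + 2)"
      using M(1) t by (intro mult_left_mono powr_mono') auto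
    finally show "cmod (\<phi> ?w) \<le> M * (1 - t) powr - (b + 2)" .
  qed auto

  define K1 where "K1 = 2 * M * C2"
  define K2 where "K2 = D * C1"
  have K: "K1 \<ge> 0" "K2 \<ge> 0" using M C1 C2 D by (auto simp: K1_def K2_def)
  \<comment> \<open>The comparison constant keeps only the far part at angle \<open>a\<close>, since
    the near part there is out of reach of \<open>size\<close> when
    \<open>cis a = 1\<close>.\<close>
  have osc: "cmod (G x - (LINT t:{0..<1} \<inter> {..<1 - l}|mu. \<phi> (complex_of_real t * cis a)))
      \<le> K1 * l powr - e + K2 * l powr (g - e) * cmod (1 - cis x) powr - g"
    if l: "l > 0" and xa: "\<bar>x - a\<bar> \<le> l" and x: "cis x \<noteq> 1" for l x a
  proof -
    let ?far = "{0..<1} \<inter> {..<1 - l}" and ?near = "{0..<1} \<inter> {1 - l..}"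
    let ?q = "D * cmod (1 - cis x) powr - g"
    have wi: "set_integrable mu ?near (\<lambda>t. ?q * (1 - t) powr - p)" using C1(2)[OF l] by simp
    have near: "set_integrable mu ?near (\<lambda>t. \<phi> (complex_of_real t * cis x))"
      "cmod (LINT t:?near|mu. \<phi> (complex_of_real t * cis x)) \<le> (LINT t:?near|mu. ?q * (1 - t) powr - p)"
      by (rule radial_integral_bound[OF cont _ _ _ wi]; use size[of _ 1 x] x in auto)+
    have "{0..<1} = ?far \<union> ?near" by auto
    then have "G x = (LINT t:?far \<union> ?near|mu. \<phi> (complex_of_real t * cis x))" by (simp add: G_def)
    also have "\<dots> = (LINT t:?far|mu. \<phi> (complex_of_real t * cis x)) + (LINT t:?near|mu. \<phi> (complex_of_real t * cis x))"
      by (rule set_integral_Un[OF _ far_int[OF l] near(1)]) auto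
    finally have split: "G x - (LINT t:?far|mu. \<phi> (complex_of_real t * cis a))
        = (LINT t:?far|mu. \<phi> (complex_of_real t * cis x) - \<phi> (complex_of_real t * cis a))
          + (LINT t:?near|mu. \<phi> (complex_of_real t * cis x))"
      using far_int[OF l] by (simp add: set_integral_diff)
    have far_le: "cmod (LINT t:?far|mu. \<phi> (complex_of_real t * cis x) - \<phi> (complex_of_real t * cis a)) \<le> K1 * l powr - e"
    proof -
      have int: "set_integrable mu ?far (\<lambda>t. \<phi> (complex_of_real t * cis x) - \<phi> (complex_of_real t * cis a))"
        using far_int[OF l] by (intro set_integral_diff)
      have "cmod (LINT t:?far|mu. \<phi> (complex_of_real t * cis x) - \<phi> (complex_of_real t * cis a))
          \<le> (LINT t:?far|mu. cmod (\<phi> (complex_of_real t * cis x) - \<phi> (complex_of_real t * cis a)))"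
        by (rule set_integral_norm_bound[OF int])
      also have "\<dots> \<le> (LINT t:?far|mu. (2 * M * l) * (1 - t) powr - (b + 2))"
      proof (rule set_integral_mono)
        show "set_integrable mu ?far (\<lambda>t. cmod (\<phi> (complex_of_real t * cis x) - \<phi> (complex_of_real t * cis a)))"
          using int by (rule set_integrable_norm)
        show "set_integrable mu ?far (\<lambda>t. (2 * M * l) * (1 - t) powr - (b + 2))" using C2(2)[OF l] by simp
        fix t assume "t \<in> ?far"
        then have "cmod (\<phi> (complex_of_real t * cis x) - \<phi> (complex_of_real t * cis a)) \<le> 2 * M * (1 - t) powr - (b + 2) * \<bar>x - a\<bar>"
          by (intro lipschitz) auto
        also have "\<dots> \<le> 2 * M * (1 - t) powr - (b + 2) * l" using M xa by (intro mult_left_mono) auto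
        finally show "cmod (\<phi> (complex_of_real t * cis x) - \<phi> (complex_of_real t * cis a)) \<le> (2 * M * l) * (1 - t) powr - (b + 2)"
          by (simp only: mult_ac)
      qed
      also have "\<dots> = (2 * M * l) * (LINT t:?far|mu. (1 - t) powr - (b + 2))" by (rule set_integral_mult_right)
      also have "\<dots> \<le> (2 * M * l) * (C2 * l powr (s - (b + 2)))" using C2(3)[OF l] M l by (intro mult_left_mono) auto
      also have "\<dots> = K1 * (l powr 1 * l powr (s - (b + 2)))" using l by (simp add: K1_def)
      also have "l powr 1 * l powr (s - (b + 2)) = l powr - e" unfolding powr_add[symmetric] exps ..
      finally show ?thesis .
    qed
    have near_le: "cmod (LINT t:?near|mu. \<phi> (complex_of_real t * cis x)) \<le> K2 * l powr (g - e) * cmod (1 - cis x) powr - g"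
    proof -
      note near(2)
      also have "(LINT t:?near|mu. ?q * (1 - t) powr - p) = ?q * (LINT t:?near|mu. (1 - t) powr - p)" by (rule set_integral_mult_right)
      also have "\<dots> \<le> ?q * (C1 * l powr (s - p))" using C1(3)[OF l] D by (intro mult_left_mono) auto
      finally show ?thesis unfolding exps K2_def by (simp only: mult_ac)
    qed
    show ?thesis
      unfolding split by (intro order_trans[OF norm_triangle_ineq] add_mono far_le near_le)
  qed

  show ?thesis
  proof (rule morreyI[OF hardy])
    show "boundary_fun (cesaro_op mu f) \<in> borel_measurable borel"
      by (rule boundary_fun_measurable[OF holomorphic_cesaro_op[OF hol] lim])
    show "0 \<le> 2 * K1\<^sup>2 + 2 * K2\<^sup>2 * C3" using C3 by simp
    fix a l :: real assume l: "0 < l" "l \<le> 2 * pi"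
    let ?c = "LINT t:{0..<1} \<inter> {..<1 - l}|mu. \<phi> (complex_of_real t * cis a)"
    \<comment> \<open>Coefficients of the squares of the two terms of \<open>osc\<close>. Integrated
      over the arc, the squares give, up to constants, \<open>l powr (1 - 2 * e)\<close> and
      \<open>l powr (2 * (g - e) + (1 - 2 * g))\<close>, both equal to
      \<open>l powr lam\<close>.\<close>
    let ?A = "2 * K1\<^sup>2 * l powr - (2 * e)" and ?B = "2 * K2\<^sup>2 * l powr (2 * (g - e))"
    have "(\<integral>\<^sup>+x\<in>{a..a+l}. ennreal ((cmod (boundary_fun (cesaro_op mu f) x - ?c))\<^sup>2) \<partial>lborel)
       \<le> (\<integral>\<^sup>+x. ennreal ?A * indicator {a..a+l} x + ennreal ?B * (ennreal (cmod (1 - cis x) powr - (2 * g)) * indicator {a..a+l} x) \<partial>lborel)"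
    proof (rule nn_integral_mono_AE)
      show "AE x in lborel. ennreal ((cmod (boundary_fun (cesaro_op mu f) x - ?c))\<^sup>2) * indicator {a..a+l} x
        \<le> ennreal ?A * indicator {a..a+l} x + ennreal ?B * (ennreal (cmod (1 - cis x) powr - (2 * g)) * indicator {a..a+l} x)"
        using AE_cis_neq_1
      proof eventually_elim
        case (elim x)
        show ?case
        proof (cases "x \<in> {a..a+l}")
          case True
          let ?u = "K1 * l powr - e" and ?v = "K2 * l powr (g - e) * cmod (1 - cis x) powr - g"
          have "cmod (boundary_fun (cesaro_op mu f) x - ?c) \<le> ?u + ?v"
            unfolding boundary_fun_eqI[OF lim[OF elim]] by (rule osc) (use True l elim in auto)
          then have "(cmod (boundary_fun (cesaro_op mu f) x - ?c))\<^sup>2 \<le> (?u + ?v)\<^sup>2" by (intro power_mono) auto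
          also have "\<dots> \<le> 2 * ?u\<^sup>2 + 2 * ?v\<^sup>2"
            using zero_le_power2[of "?u - ?v"] unfolding power2_sum power2_diff by linarith
          also have "\<dots> = ?A + ?B * cmod (1 - cis x) powr - (2 * g)"
            by (simp add: power_mult_distrib powr_squared)
          finally have "ennreal ((cmod (boundary_fun (cesaro_op mu f) x - ?c))\<^sup>2) \<le> ennreal (?A + ?B * cmod (1 - cis x) powr - (2 * g))"
            by (rule ennreal_leI)
          also have "\<dots> = ennreal ?A + ennreal ?B * ennreal (cmod (1 - cis x) powr - (2 * g))"
            by (simp add: ennreal_mult)
          finally show ?thesis using True by simp
        qed simp
      qed
    qed
    also have "\<dots> = ennreal ?A * ennreal l + ennreal ?B * (\<integral>\<^sup>+x\<in>{a..a+l}. ennreal (cmod (1 - cis x) powr - (2 * g)) \<partial>lborel)"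
      using l by (simp add: nn_integral_add nn_integral_cmult nn_integral_cmult_indicator)
    also have "\<dots> \<le> ennreal ?A * ennreal l + ennreal ?B * ennreal (C3 * l powr (1 - 2 * g))"
      by (intro add_left_mono mult_left_mono C3(2)[OF l]) auto
    also have "\<dots> = ennreal (?A * l + ?B * (C3 * l powr (1 - 2 * g)))"
      using l C3(1) by (simp add: ennreal_mult)
    also have "?A * l + ?B * (C3 * l powr (1 - 2 * g)) = 2 * K1\<^sup>2 * (l powr - (2 * e) * l powr 1) + 2 * K2\<^sup>2 * C3 * (l powr (2 * (g - e)) * l powr (1 - 2 * g))"
      using l by simp
    also have "l powr - (2 * e) * l powr 1 = l powr lam"
      unfolding powr_add[symmetric] exps(3)[symmetric] by (simp add: algebra_simps)
    also have "l powr (2 * (g - e)) * l powr (1 - 2 * g) = l powr lam"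
      unfolding powr_add[symmetric] exps(3)[symmetric] by (simp add: algebra_simps)
    finally show "\<exists>c. (\<integral>\<^sup>+x\<in>{a..a+l}. ennreal ((cmod (boundary_fun (cesaro_op mu f) x - c))\<^sup>2) \<partial>lborel)
        \<le> ennreal ((2 * K1\<^sup>2 + 2 * K2\<^sup>2 * C3) * l powr lam)"
      by (intro exI[of _ ?c]) (simp only: distrib_right)
  qed
qed

end

section \<open>The two directions of the equivalence\<close>

theorem theorem1p5:
  fixes mu :: "real measure"
    and X Y :: "(complex \<Rightarrow> complex) set"
    and NX NY :: "(complex \<Rightarrow> complex) \<Rightarrow> real"
    and lam1 lam2 :: real
  assumes "0 < lam1" "lam1 < 1" "0 < lam2" "lam2 \<le> 1"
    and "sets mu = sets borel" "finite_measure mu" "emeasure mu (- {0..<1}) = 0"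
    and "banach_analytic X NX" "banach_analytic Y NY"
    and "subspace_on_disc (morrey lam1) X" "subspace_on_disc X (bloch_type ((3 - lam1) / 2))"
    and "subspace_on_disc (morrey lam2) Y" "subspace_on_disc Y (bloch_type ((3 - lam2) / 2))"
  shows "bounded_op_on (cesaro_op mu) X NX Y NY \<longleftrightarrow> carleson mu (1 + (lam2 - lam1) / 2)"
proof -
  interpret unit_interval_measure mu
    using assms(5-7) by (simp add: unit_interval_measure_def unit_interval_measure_axioms_def)
  define b where "b = (1 - lam1) / 2"
  have b: "0 < b" "(3 - lam1) / 2 = b + 1" using assms(2) by (auto simp: b_def field_simps)
  note X = \<open>banach_analytic X NX\<close> and Y = \<open>banach_analytic Y NY\<close>
  show ?thesis
  proof
    let ?F = "\<lambda>z. (1 - z) powr complex_of_real (- b)"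
    assume T: "bounded_op_on (cesaro_op mu) X NX Y NY"
    have "?F \<in> morrey lam1" using one_minus_powr_in_morrey assms(1,2) b_def by blast
    then have F: "?F holomorphic_on ball 0 1" and "\<exists>f\<in>X. \<forall>z\<in>ball 0 1. f z = ?F z"
      using assms(10) by (auto simp: morrey_def hardy2_def subspace_on_disc_def)
    \<comment> \<open>\<open>X\<close> contains the test function only up to values off the disc, so
      a member agreeing with it there stands in.\<close>
    then obtain f where f: "f \<in> X" "\<And>z. z \<in> ball 0 1 \<Longrightarrow> f z = ?F z" by blast
    obtain g where g: "g \<in> Y" "\<And>z. z \<in> ball 0 1 \<Longrightarrow> g z = cesaro_op mu f z"
      using T f(1) unfolding bounded_op_on_def by blast
    obtain h where h: "h \<in> bloch_type ((3 - lam2) / 2)" "\<And>z. z \<in> ball 0 1 \<Longrightarrow> h z = g z"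
      using assms(13) g(1) unfolding subspace_on_disc_def by blast
    have "carleson mu (b + 2 - (3 - lam2) / 2)"
      by (rule carleson_if_cesaro_op_bloch[OF b(1) _ _ h(1) _ F])
        (use assms(3,4) b(1) h(2) g(2) cesaro_op_cong[OF F f(2)] in auto)
    moreover have "b + 2 - (3 - lam2) / 2 = 1 + (lam2 - lam1) / 2" by (simp add: b_def field_simps)
    ultimately show "carleson mu (1 + (lam2 - lam1) / 2)" by simp
  next
    assume "carleson mu (1 + (lam2 - lam1) / 2)"
    moreover have "1 + (lam2 - lam1) / 2 = b + (1 + lam2) / 2" by (simp add: b_def field_simps)
    ultimately have car: "carleson mu (b + (1 + lam2) / 2)" by simp
    show "bounded_op_on (cesaro_op mu) X NX Y NY"
    proof (rule banach_analytic_closed_graph[OF X Y])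
      \<comment> \<open>\<open>f\<close> is replaced by its Bloch representative \<open>k\<close>,
        whose image lies in \<open>morrey lam2\<close> and so is represented in
        \<open>Y\<close>.\<close>
      fix f assume "f \<in> X"
      then obtain k where k: "k \<in> bloch_type (b + 1)" "\<And>z. z \<in> ball 0 1 \<Longrightarrow> k z = f z"
        using assms(11) unfolding subspace_on_disc_def b(2) by blast
      have "cesaro_op mu k \<in> morrey lam2" by (rule cesaro_op_in_morrey[OF b(1) assms(3,4) car k(1)])
      then obtain g where "g \<in> Y" "\<And>z. z \<in> ball 0 1 \<Longrightarrow> g z = cesaro_op mu k z"
        using assms(12) unfolding subspace_on_disc_def by blast
      then show "\<exists>g\<in>Y. \<forall>z\<in>ball 0 1. g z = cesaro_op mu f z"
        using cesaro_op_cong[OF banach_analytic_holomorphic[OF X \<open>f \<in> X\<close>] k(2)]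
        by (intro bexI[of _ g]) auto
    next
      fix z :: complex assume z: "z \<in> ball 0 1"
      obtain C where C: "\<And>f w. f \<in> X \<Longrightarrow> w \<in> cball 0 (cmod z) \<Longrightarrow> cmod (f w) \<le> C * NX f"
        using banach_analytic_eval[OF X, of "cball 0 (cmod z)"] z by fastforce
      have "cmod (cesaro_op mu f z) \<le> (measure mu {0..<1} / (1 - cmod z) * C) * NX f" if "f \<in> X" for f
        using cesaro_op_pointwise_bound(2)[OF banach_analytic_holomorphic[OF X that] z C[OF that]]
        by (simp only: mult.assoc)
      then show "\<exists>C. \<forall>f\<in>X. cmod (cesaro_op mu f z) \<le> C * NX f" by blast
    qed (simp_all add: cesaro_op_diff cesaro_op_scale banach_analytic_holomorphic[OF X])
  qed
qed

end
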